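(* Let $n\ge2$, $p>n$, $m=\frac{p-n}{p-1}$, $R>0$, and $B_R=\{x\in\mathbb{R}^n:|x|<R\}$. Then $$\lambda_{p,n}(B_R)\ge\left(\frac1{pR}\right)^p\left[\frac{(p-1)^{p-1}}{(n-1)^{n-1}}\right]^{\frac p{p-n}}\left\{1+\frac p{4(p-1)}\left[1+\sqrt{\frac{5p-7}{3(p-1)}}-2\ln m-2\ln\tau\right]^{-2}\right\},$$ where $$\tau=1-4(1-m)\left[p\left(1+\sqrt{\frac{5p-7}{3(p-1)}}-2\ln m\right)-4m\right]^{-1}\in(0,1).$$
   Context: $\lambda_{p,n}(\Omega)$ is the first eigenvalue of the $p$-Laplacian $\Delta_pu=\operatorname{div}(|\nabla u|^{p-2}\nabla u)$ in $\Omega\subset\mathbb{R}^n$ with zero Dirichlet boundary condition, i.e. $\lambda_{p,n}(\Omega)=\inf_{u\in W^{1,p}_0(\Omega)\setminus\{0\}}\int_\Omega|\nabla u|^pdx\big/\int_\Omega|u|^pdx$. *)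

theory Defs
  imports "HOL-Analysis.Analysis"
begin

primrec C_k :: "nat \<Rightarrow> ('a::euclidean_space \<Rightarrow> real) \<Rightarrow> bool" where
  "C_k 0 f \<longleftrightarrow> continuous_on UNIV f"
| "C_k (Suc k) f \<longleftrightarrow>
     (\<forall>x. f differentiable (at x)) \<and> (\<forall>i\<in>Basis. C_k k (\<lambda>x. frechet_derivative f (at x) i))"

definition gradient :: "('a::euclidean_space \<Rightarrow> real) \<Rightarrow> 'a \<Rightarrow> 'a" where
  "gradient f x = (\<Sum>i\<in>Basis. frechet_derivative f (at x) i *\<^sub>R i)"

text \<open>The space of smooth functions with compact support inside \<open>\<Omega>\<close>.\<close>
definition test_function :: "'a::euclidean_space set \<Rightarrow> ('a \<Rightarrow> real) \<Rightarrow> bool" where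
  "test_function \<Omega> \<phi> \<longleftrightarrow> (\<forall>k. C_k k \<phi>) \<and>
     compact (closure {x. \<phi> x \<noteq> 0}) \<and> closure {x. \<phi> x \<noteq> 0} \<subseteq> \<Omega>"

definition locally_integrable :: "'a::euclidean_space set \<Rightarrow> ('a \<Rightarrow> 'b::euclidean_space) \<Rightarrow> bool" where
  "locally_integrable \<Omega> f \<longleftrightarrow> (\<forall>K. compact K \<and> K \<subseteq> \<Omega> \<longrightarrow> f absolutely_integrable_on K)"

definition has_weak_gradient :: "'a::euclidean_space set \<Rightarrow> ('a \<Rightarrow> real) \<Rightarrow> ('a \<Rightarrow> 'a) \<Rightarrow> bool" where
  "has_weak_gradient \<Omega> u g \<longleftrightarrow> locally_integrable \<Omega> u \<and> locally_integrable \<Omega> g \<and>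
     (\<forall>\<phi>. test_function \<Omega> \<phi> \<longrightarrow> (\<forall>i\<in>Basis.
        (LINT x|lebesgue_on \<Omega>. u x * (gradient \<phi> x \<bullet> i)) =
        - (LINT x|lebesgue_on \<Omega>. (g x \<bullet> i) * \<phi> x)))"

definition Lp_function :: "real \<Rightarrow> 'a::euclidean_space set \<Rightarrow> ('a \<Rightarrow> 'b::euclidean_space) \<Rightarrow> bool" where
  "Lp_function p \<Omega> f \<longleftrightarrow> f \<in> borel_measurable (lebesgue_on \<Omega>) \<and>
     integrable (lebesgue_on \<Omega>) (\<lambda>x. norm (f x) powr p)"

text \<open>\<open>W1p p \<Omega> u g\<close>: the function \<open>u\<close> is in \<open>W\<^sup>1\<^sup>,\<^sup>p(\<Omega>)\<close>
  and \<open>g\<close> is a representative of its weak gradient (which is unique up to null sets).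
  Functions are not identified when they agree almost everywhere.\<close>
definition W1p :: "real \<Rightarrow> 'a::euclidean_space set \<Rightarrow> ('a \<Rightarrow> real) \<Rightarrow> ('a \<Rightarrow> 'a) \<Rightarrow> bool" where
  "W1p p \<Omega> u g \<longleftrightarrow> Lp_function p \<Omega> u \<and> Lp_function p \<Omega> g \<and> has_weak_gradient \<Omega> u g"

text \<open>The closure of the test functions in the norm of \<open>W\<^sup>1\<^sup>,\<^sup>p(\<Omega>)\<close>,
  again together with a weak gradient.\<close>
definition W1p_0 :: "real \<Rightarrow> 'a::euclidean_space set \<Rightarrow> ('a \<Rightarrow> real) \<Rightarrow> ('a \<Rightarrow> 'a) \<Rightarrow> bool" where
  "W1p_0 p \<Omega> u g \<longleftrightarrow> W1p p \<Omega> u g \<and>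
     (\<exists>\<phi>. (\<forall>k::nat. test_function \<Omega> (\<phi> k)) \<and>
        (\<lambda>k. LINT x|lebesgue_on \<Omega>. \<bar>\<phi> k x - u x\<bar> powr p) \<longlonglongrightarrow> 0 \<and>
        (\<lambda>k. LINT x|lebesgue_on \<Omega>. norm (gradient (\<phi> k) x - g x) powr p) \<longlonglongrightarrow> 0)"

text \<open>The infimum is taken in the reals: it is meaningful for \<open>p > 1\<close> and
  \<open>\<Omega>\<close> open and nonempty, where the set of quotients is nonempty and bounded below by 0.\<close>
definition p_laplace_eigenvalue :: "real \<Rightarrow> 'a::euclidean_space set \<Rightarrow> real" where
  "p_laplace_eigenvalue p \<Omega> =
     Inf {(LINT x|lebesgue_on \<Omega>. norm (g x) powr p) / (LINT x|lebesgue_on \<Omega>. \<bar>u x\<bar> powr p) | u g.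
            W1p_0 p \<Omega> u g \<and> \<not> (AE x in lebesgue_on \<Omega>. u x = 0)}"

end

theory Submission
  imports Defs
begin

text \<open>Comparing \<open>|\<nabla>u|\<^sup>p\<close> with the radial derivative reduces the bound to an inequality on each ray:
  for \<open>v(1) = 0\<close> one needs \<open>\<Lambda> \<integral> |v|\<^sup>p r\<^sup>n\<^sup>-\<^sup>1 dr \<le> \<integral> |v'|\<^sup>p r\<^sup>n\<^sup>-\<^sup>1 dr\<close> over \<open>(0,1)\<close>.  By Young's inequality,
  \<open>(G |v|\<^sup>p)' + r\<^sup>n\<^sup>-\<^sup>1 (|v'|\<^sup>p - \<Lambda> |v|\<^sup>p) \<ge> 0\<close> as soon as \<open>G \<ge> 0\<close> satisfies the Riccati inequality
  \<open>G' \<ge> (p - 1) r\<^sup>m\<^sup>-\<^sup>1 G\<^sup>q + \<Lambda> r\<^sup>n\<^sup>-\<^sup>1\<close> with \<open>q = p / (p - 1)\<close>, and integrating gives the claim.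
  With \<open>z = 1 - r\<^sup>m\<close>, the choice \<open>G = c z\<^sup>1\<^sup>-\<^sup>p\<close> is the one behind Hardy's inequality, and the factor
  \<open>1 - 1 / (1 + s - 2 ln z)\<close> produces the logarithmic improvement.  The constant \<open>\<Lambda>\<close> comes from the
  minimum of the resulting weight, whose Hardy part is smallest at \<open>z = m\<close>.\<close>

section \<open>A radial Riccati inequality\<close>

text \<open>Bernoulli's inequality, read off from convexity of \<open>exp\<close> at the points 0
  and \<open>ln x\<close> with weights \<open>1 - a\<close> and \<open>a\<close>.\<close>

lemma powr_le_linear:
  fixes x a :: real
  assumes "0 < x" "0 \<le> a" "a \<le> 1"
  shows "x powr a \<le> 1 + a * (x - 1)"
proof -
  have "exp ((1 - a) *\<^sub>R 0 + a *\<^sub>R ln x) \<le> (1 - a) * exp 0 + a * exp (ln x)"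
    by (rule convex_onD[OF exp_convex]) (use assms in auto)
  then show ?thesis using assms by (simp add: powr_def algebra_simps)
qed

text \<open>The right side has its maximum 1 at \<open>h = 1\<close>, and leaving this point costs
  at most a square. This is Bernoulli's inequality for the exponent \<open>1 / (p - 1)\<close>,
  which is at most 1 because \<open>p \<ge> 2\<close>.\<close>

lemma conjugate_power_bound:
  fixes h p :: real
  assumes "0 < h" "2 \<le> p"
  shows "1 - (1 - h)\<^sup>2 \<le> p * h - (p - 1) * h powr (p / (p - 1))"
proof -
  have "h powr (1 / (p - 1)) \<le> 1 + 1 / (p - 1) * (h - 1)"
    by (rule powr_le_linear) (use assms in auto)
  moreover have "h powr (p / (p - 1)) = h * h powr (1 / (p - 1))"
  proof -
    have "p / (p - 1) = 1 + 1 / (p - 1)" using assms by (simp add: field_simps)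
    then show ?thesis using assms by (simp add: powr_add)
  qed
  ultimately have "(p - 1) * h powr (p / (p - 1)) \<le> (p - 1) * (h * (1 + 1 / (p - 1) * (h - 1)))"
    using assms by (intro mult_left_mono) auto
  also have "\<dots> = (p - 1) * h + h * (h - 1)" using assms by (simp add: field_simps)
  finally show ?thesis by (simp add: power2_eq_square algebra_simps)
qed

text \<open>The reciprocal of the Hardy weight in the variable \<open>z = 1 - r\<^sup>m\<close>, normalised to be 1 at its
  maximum \<open>z = m\<close>.\<close>

definition hardy_profile :: "real \<Rightarrow> real \<Rightarrow> real \<Rightarrow> real" where
  "hardy_profile p m z = (z / m) powr p * ((1 - z) / (1 - m)) powr (p * (1 - m) / m)"

text \<open>Replacing the logarithm of \<open>(1 - z) / (1 - m)\<close> by its tangent at 1 makes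
  the factor \<open>(1 - m) / m\<close> cancel, so that \<open>z\<close> and \<open>m\<close> enter
  the bound only through \<open>z / m\<close>.\<close>

lemma hardy_profile_le_exp:
  assumes "0 < m" "m < 1" "0 < z" "z < 1" "0 \<le> p"
  shows "hardy_profile p m z \<le> exp (p * (ln (z / m) + 1 - z / m))"
proof -
  have "hardy_profile p m z = exp (p * (ln (z / m) + (1 - m) / m * ln ((1 - z) / (1 - m))))"
    using assms by (simp add: hardy_profile_def powr_def exp_add[symmetric] algebra_simps)
  also have "\<dots> \<le> exp (p * (ln (z / m) + (1 - m) / m * ((1 - z) / (1 - m) - 1)))"
    using assms by (intro iffD2[OF exp_le_cancel_iff] mult_left_mono add_left_mono ln_le_minus_one) auto
  also have "(1 - m) / m * ((1 - z) / (1 - m) - 1) = 1 - z / m"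
    using assms by (simp add: field_simps)
  finally show ?thesis by (simp add: algebra_simps)
qed

text \<open>The Hardy weight pays for the logarithmic factor: either \<open>D \<le> 2 B\<close>, where the factor 4 between
  the two constants suffices, or \<open>z / m \<le> 1 / e\<close>, where the profile is at most \<open>exp (- p / e)\<close>.\<close>

lemma hardy_profile_log_bound:
  fixes A B D m p z \<mu> :: real
  assumes "0 < m" "m < 1" "0 < z" "z < 1" "2 \<le> p" "0 < \<mu>" "\<mu> \<le> m" "2 \<le> A"
  defines "B \<equiv> A - 2 * ln \<mu>" and "D \<equiv> A - 2 * ln z"
  shows "(1 + p / (4 * (p - 1)) / B\<^sup>2) * hardy_profile p m z \<le> 1 + p / (p - 1) / D\<^sup>2"
proof -
  define y where "y = z / m"
  have y: "0 < y" using assms by (simp add: y_def)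
  have B: "2 \<le> B" using assms(1,2,6-8) unfolding B_def by (smt (verit) ln_le_zero_iff)
  have D: "2 \<le> D" using assms(3,4,8) unfolding D_def by (smt (verit) ln_le_zero_iff)
  have W: "hardy_profile p m z \<le> exp (p * (ln y + 1 - y))"
    unfolding y_def using assms by (intro hardy_profile_le_exp) auto
  show ?thesis
  proof (cases "D \<le> 2 * B")
    case True
    have "p * (ln y + 1 - y) \<le> 0"
      using ln_le_minus_one[OF y] assms by (intro mult_nonneg_nonpos) auto
    with W have W1: "hardy_profile p m z \<le> 1" by (smt (verit) exp_le_one_iff)
    have "D\<^sup>2 \<le> (2 * B)\<^sup>2" using True D by (intro power_mono) auto
    then have "p / (p - 1) / (2 * B)\<^sup>2 \<le> p / (p - 1) / D\<^sup>2"
      using D B assms by (intro divide_left_mono) auto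
    then have *: "p / (4 * (p - 1)) / B\<^sup>2 \<le> p / (p - 1) / D\<^sup>2"
      by (simp add: power_mult_distrib algebra_simps)
    have "(1 + p / (4 * (p - 1)) / B\<^sup>2) * hardy_profile p m z \<le> (1 + p / (4 * (p - 1)) / B\<^sup>2) * 1"
      using W1 assms by (intro mult_left_mono add_nonneg_nonneg) auto
    also have "\<dots> \<le> 1 + p / (p - 1) / D\<^sup>2" using * unfolding mult_1_right by (rule add_left_mono)
    finally show ?thesis .
  next
    case False
    then have "2 * B < D" by simp
    \<comment> \<open>\<open>2 * B < D\<close> rearranges to
      \<open>2 * ln z < 2 * ln \<mu> - B\<close>, and \<open>B \<ge> 2\<close>.\<close>
    then have "ln z < ln \<mu> - 1" using B unfolding B_def D_def by argo
    moreover have "ln \<mu> \<le> ln m" using assms by simp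
    moreover have "ln y = ln z - ln m" using assms by (simp add: y_def ln_div)
    ultimately have ly: "ln y \<le> - 1" by argo
    then have ye: "y \<le> exp (- 1)" using y by (metis exp_le_cancel_iff exp_ln)
    have e3: "exp 1 \<le> (3::real)" by (rule exp_le)
    \<comment> \<open>With \<open>e = exp 1\<close>, applying \<open>ln x \<le> x - 1\<close> at
      \<open>x = e y\<close> gives the tangent of \<open>ln\<close> at \<open>1 / e\<close>, the
      right end of the range of \<open>y\<close>. The resulting bound increases in \<open>y\<close>
      and equals \<open>- 1 / e\<close> there.\<close>
    have "ln (exp 1 * y) \<le> exp 1 * y - 1" using y by (intro ln_le_minus_one) auto
    then have "ln y + 1 - y \<le> (exp 1 - 1) * y - 1" using y by (simp add: ln_mult algebra_simps)
    also have "\<dots> \<le> (exp 1 - 1) * exp (- 1) - 1"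
      using ye by (intro diff_right_mono mult_left_mono) auto
    also have "\<dots> = - exp (- 1)" by (simp add: algebra_simps exp_minus)
    also have "\<dots> \<le> - 1 / 3" using e3 by (simp add: exp_minus field_simps)
    finally have "p * (ln y + 1 - y) \<le> p * (- 1 / 3)" using assms by (intro mult_left_mono) auto
    then have 1: "p * (ln y + 1 - y) \<le> - 2 / 3" using assms by simp
    have c: "p / (4 * (p - 1)) \<le> 1 / 2" using assms by (simp add: field_simps)
    have "4 \<le> B\<^sup>2" using power_mono[OF B, of 2] by simp
    then have "p / (4 * (p - 1)) / B\<^sup>2 \<le> (1 / 2) / 4" using c by (intro frac_le[OF _ c]) simp_all
    then have 2: "p / (4 * (p - 1)) / B\<^sup>2 \<le> 1 / 8" by simp
    \<comment> \<open>In the exponent the logarithmic term adds at most \<open>1 / 8\<close>, while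
      the profile takes away at least \<open>2 / 3\<close>.\<close>
    have "(1 + p / (4 * (p - 1)) / B\<^sup>2) * hardy_profile p m z
        \<le> exp (p / (4 * (p - 1)) / B\<^sup>2) * exp (p * (ln y + 1 - y))"
      using W assms by (intro mult_mono exp_ge_add_one_self) (auto simp: hardy_profile_def)
    also have "\<dots> = exp (p / (4 * (p - 1)) / B\<^sup>2 + p * (ln y + 1 - y))" by (simp add: exp_add)
    also have "\<dots> \<le> 1" using 1 2 by simp
    finally show ?thesis using assms D by (smt (verit) divide_nonneg_nonneg zero_le_power2)
  qed
qed

text \<open>All terms of the Riccati inequality share the factor
  \<open>E = r^(m - 1) \<kappa>^p z^(- p)\<close>. With \<open>q = p / (p - 1)\<close> and
  \<open>h = 1 - 1 / D\<close>, dividing by \<open>E\<close> leaves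
  \<open>p h - (p - 1) h^q + 2 q / D^2\<close>, to be bounded below by a multiple of the profile.
  The freedom in \<open>\<mu>\<close> lets \<open>\<tau>\<close> enter later.\<close>

lemma riccati_inequality:
  fixes A m p \<mu> :: real
  assumes "0 < m" "m < 1" "2 \<le> p" "0 < \<mu>" "\<mu> \<le> m" "2 \<le> A"
  defines "\<Lambda> \<equiv> ((p - 1) / p) powr p * (1 - m) powr (- (p * (1 - m) / m))
      * (1 + p / (4 * (p - 1)) / (A - 2 * ln \<mu>)\<^sup>2)"
  obtains G G' :: "real \<Rightarrow> real" where
    "\<And>r. 0 < r \<Longrightarrow> r < 1 \<Longrightarrow> 0 \<le> G r"
    "\<And>r. 0 < r \<Longrightarrow> r < 1 \<Longrightarrow> (G has_real_derivative G' r) (at r)"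
    "\<And>r. 0 < r \<Longrightarrow> r < 1 \<Longrightarrow>
       (p - 1) * r powr (m - 1) * G r powr (p / (p - 1)) + \<Lambda> * r powr ((p - 1) * (1 - m)) \<le> G' r"
proof -
  \<comment> \<open>\<open>c = \<kappa> powr (p - 1)\<close> maximises
    \<open>m * c - c powr (p / (p - 1))\<close> over \<open>c > 0\<close>, which is what
    \<open>G = c z^(1 - p)\<close> leaves in the Riccati inequality up to the factor
    \<open>(p - 1) r^(m - 1) z^(- p)\<close>.\<close>
  define \<kappa> where "\<kappa> = m * (p - 1) / p"
  define D where "D z = A - 2 * ln z" for z :: real
  define h where "h z = 1 - 1 / D z" for z
  define F where "F z = \<kappa> powr (p - 1) * z powr (- (p - 1)) * h z" for z
  define G where "G r = F (1 - r powr m)" for r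
  define G' where "G' r = m * r powr (m - 1) * (\<kappa> powr (p - 1) * (1 - r powr m) powr (- p)
      * ((p - 1) * h (1 - r powr m) + 2 / (D (1 - r powr m))\<^sup>2))" for r
  have \<kappa>: "0 < \<kappa>" using assms by (simp add: \<kappa>_def)
  have z: "0 < 1 - r powr m" "1 - r powr m < 1" if "0 < r" "r < 1" for r
    using that assms by (auto simp: powr01_less_one)
  have D: "2 \<le> D z" if "0 < z" "z < 1" for z
  proof -
    have "ln z \<le> 0" using that by simp
    with assms(6) show ?thesis unfolding D_def by linarith
  qed
  have h: "0 < h z" if "0 < z" "z < 1" for z
    using D[OF that] by (simp add: h_def field_simps)
  have F': "(F has_real_derivative - (\<kappa> powr (p - 1) * z powr (- p)
      * ((p - 1) * h z + 2 / (D z)\<^sup>2))) (at z)" if z: "0 < z" "z < 1" for z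
  proof -
    have z0: "z \<noteq> 0" "D z \<noteq> 0" using z D[of z] by auto
    have "(D has_real_derivative - 2 / z) (at z)"
      unfolding D_def using z by (auto intro!: derivative_eq_intros)
    then have h': "(h has_real_derivative - 2 / z / (D z)\<^sup>2) (at z)"
      unfolding h_def using z0
      by (auto intro!: derivative_eq_intros simp: power2_eq_square field_simps)
    have pow': "((\<lambda>z. \<kappa> powr (p - 1) * z powr (- (p - 1))) has_real_derivative
        - (p - 1) * (\<kappa> powr (p - 1) * z powr (- p))) (at z)"
      using z by (auto intro!: derivative_eq_intros)
    have split: "z powr (- (p - 1)) = z powr (- p) * z"
      using z powr_add[of z "- p" 1] by simp
    show "(F has_real_derivative - (\<kappa> powr (p - 1) * z powr (- p)
        * ((p - 1) * h z + 2 / (D z)\<^sup>2))) (at z)"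
      unfolding F_def
    proof (rule DERIV_cong[OF DERIV_mult[OF pow' h']])
      have "\<kappa> powr (p - 1) * (z powr (- p) * z) * (- 2 / z / (D z)\<^sup>2)
          = - (\<kappa> powr (p - 1) * z powr (- p) * (2 / (D z)\<^sup>2))"
        using z0 by simp
      then show "- (p - 1) * (\<kappa> powr (p - 1) * z powr (- p)) * h z
          + - 2 / z / (D z)\<^sup>2 * (\<kappa> powr (p - 1) * z powr (- (p - 1)))
        = - (\<kappa> powr (p - 1) * z powr (- p) * ((p - 1) * h z + 2 / (D z)\<^sup>2))"
        unfolding split by (simp add: algebra_simps)
    qed
  qed
  show thesis
  proof
    fix r :: real assume r: "0 < r" "r < 1"
    let ?z = "1 - r powr m"
    note z = z[OF r] and D = D[OF z] and h = h[OF z]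
    show "0 \<le> G r" using h by (simp add: G_def F_def)
    have "((\<lambda>r. 1 - r powr m) has_real_derivative - (m * r powr (m - 1))) (at r)"
      using r by (auto intro!: derivative_eq_intros)
    with F'[OF z] show "(G has_real_derivative G' r) (at r)"
      unfolding G_def G'_def by (rule DERIV_chain2[THEN DERIV_cong]) simp
    define E where "E = r powr (m - 1) * \<kappa> powr p * ?z powr (- p)"
    have Gq: "G r powr (p / (p - 1)) = \<kappa> powr p * ?z powr (- p) * h ?z powr (p / (p - 1))"
    proof -
      have "(p - 1) * (p / (p - 1)) = p" "- (p - 1) * (p / (p - 1)) = - p"
        using assms by (simp_all add: field_simps)
      then show ?thesis unfolding G_def F_def using h \<kappa> z
        by (simp only: powr_mult powr_powr)
    qed
    have kp: "\<kappa> powr p = \<kappa> * \<kappa> powr (p - 1)"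
      using \<kappa> by (simp add: powr_diff)
    have G'E: "G' r = E * (p * h ?z + 2 * (p / (p - 1)) / (D ?z)\<^sup>2)"
    proof -
      have "m * ((p - 1) * h ?z + 2 / (D ?z)\<^sup>2) = \<kappa> * (p * h ?z + 2 * (p / (p - 1)) / (D ?z)\<^sup>2)"
        using assms D by (simp add: \<kappa>_def field_simps)
      moreover have "G' r = r powr (m - 1) * \<kappa> powr (p - 1) * ?z powr (- p) * (m * ((p - 1) * h ?z + 2 / (D ?z)\<^sup>2))"
        unfolding G'_def by (simp only: mult_ac)
      ultimately show ?thesis unfolding E_def kp by (simp only: mult_ac)
    qed
    \<comment> \<open>Since \<open>1 - h = 1 / D\<close>, the loss in
      \<open>conjugate_power_bound\<close> is \<open>1 / D^2\<close>. It takes at most half of the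
      gain \<open>2 q / D^2\<close>, as \<open>q = p / (p - 1) \<ge> 1\<close>.\<close>
    have "1 + p / (p - 1) / (D ?z)\<^sup>2 \<le> 1 - (1 - h ?z)\<^sup>2 + 2 * (p / (p - 1)) / (D ?z)\<^sup>2"
      using assms D by (simp add: h_def power_divide field_simps)
    also have "\<dots> \<le> p * h ?z - (p - 1) * h ?z powr (p / (p - 1)) + 2 * (p / (p - 1)) / (D ?z)\<^sup>2"
      using conjugate_power_bound[OF h, of p] assms by simp
    finally have "(1 + p / (4 * (p - 1)) / (A - 2 * ln \<mu>)\<^sup>2) * hardy_profile p m ?z \<le> \<dots>"
      using hardy_profile_log_bound[of m ?z p \<mu> A] assms z unfolding D_def by linarith
    then have "E * ((1 + p / (4 * (p - 1)) / (A - 2 * ln \<mu>)\<^sup>2) * hardy_profile p m ?z)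
        \<le> E * (p * h ?z - (p - 1) * h ?z powr (p / (p - 1)) + 2 * (p / (p - 1)) / (D ?z)\<^sup>2)"
      by (intro mult_left_mono) (auto simp: E_def)
    also have "\<dots> = G' r - (p - 1) * r powr (m - 1) * G r powr (p / (p - 1))"
      unfolding G'E Gq by (simp add: E_def algebra_simps)
    \<comment> \<open>With \<open>1 - z = r^m\<close> the profile supplies
      \<open>r^(p (1 - m))\<close>, its power of \<open>z\<close> cancels the one in
      \<open>E\<close>, and its power of \<open>m\<close> the one in \<open>\<kappa>^p\<close>. Only
      the radial weight and the constant remain.\<close>
    also have "E * ((1 + p / (4 * (p - 1)) / (A - 2 * ln \<mu>)\<^sup>2) * hardy_profile p m ?z)
        = \<Lambda> * r powr ((p - 1) * (1 - m))"
    proof -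
      have e: "(p - 1) * (1 - m) = (m - 1) + p * (1 - m)" by (simp add: algebra_simps)
      have "hardy_profile p m ?z = ?z powr p * m powr (- p) * r powr (p * (1 - m)) * (1 - m) powr (- (p * (1 - m) / m))"
        unfolding hardy_profile_def using assms r z
        by (simp add: powr_divide powr_powr powr_minus divide_simps)
      moreover have "\<kappa> powr p * m powr (- p) = ((p - 1) / p) powr p"
        using assms by (simp add: \<kappa>_def powr_mult powr_divide powr_minus)
      moreover have "?z powr (- p) * ?z powr p = 1" using z by (simp add: powr_minus)
      ultimately have "\<kappa> powr p * ?z powr (- p) * hardy_profile p m ?z
          = ((p - 1) / p) powr p * r powr (p * (1 - m)) * (1 - m) powr (- (p * (1 - m) / m))"
        by algebra
      then show ?thesis unfolding E_def \<Lambda>_def e powr_add by algebra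
    qed
    finally show "(p - 1) * r powr (m - 1) * G r powr (p / (p - 1)) + \<Lambda> * r powr ((p - 1) * (1 - m)) \<le> G' r"
      by linarith
  qed
qed

section \<open>The inequality on rays\<close>

lemma has_real_derivative_abs_powr:
  fixes x p :: real
  assumes "1 < p"
  shows "((\<lambda>x. \<bar>x\<bar> powr p) has_real_derivative p * \<bar>x\<bar> powr (p - 1) * sgn x) (at x)"
proof -
  consider "0 < x" | "x < 0" | "x = 0" by linarith
  then show ?thesis
  proof cases
    case 1
    have "((\<lambda>x. x powr p) has_real_derivative p * \<bar>x\<bar> powr (p - 1) * sgn x) (at x)"
      using 1 by (auto intro!: derivative_eq_intros)
    then show ?thesis
      by (rule has_field_derivative_transform_within_open[where S = "{0<..}"]) (use 1 in auto)
  next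
    case 2
    have "((\<lambda>x. (- x) powr p) has_real_derivative p * \<bar>x\<bar> powr (p - 1) * sgn x) (at x)"
      using 2 by (auto intro!: derivative_eq_intros)
    then show ?thesis
      by (rule has_field_derivative_transform_within_open[where S = "{..<0}"]) (use 2 in auto)
  next
    case 3
    \<comment> \<open>At 0 the difference quotient has absolute value
      \<open>\<bar>h\<bar> powr (p - 1)\<close>, and \<open>p > 1\<close>.\<close>
    have "((\<lambda>h::real. \<bar>h\<bar> powr (p - 1)) \<longlongrightarrow> 0) (at 0)"
      by (rule tendsto_zero_powrI[where b = "p - 1"]) (use assms in \<open>auto intro!: tendsto_eq_intros\<close>)
    then have "((\<lambda>h::real. \<bar>\<bar>h\<bar> powr p / h\<bar>) \<longlongrightarrow> 0) (at 0)"
    proof (rule Lim_transform_eventually)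
      show "\<forall>\<^sub>F h::real in at 0. \<bar>h\<bar> powr (p - 1) = \<bar>\<bar>h\<bar> powr p / h\<bar>"
        by (auto simp: eventually_at_filter powr_diff abs_divide intro!: always_eventually)
    qed
    then have "((\<lambda>h::real. \<bar>h\<bar> powr p / h) \<longlongrightarrow> 0) (at 0)" by (rule tendsto_rabs_zero_cancel)
    then show ?thesis using 3 assms by (simp add: DERIV_def)
  qed
qed

text \<open>Controls the cross term of \<open>(G |v|^p)'\<close>, with \<open>g = G\<close>,
  \<open>X = |v|\<close> and \<open>Y = |v'|\<close>.\<close>

lemma weighted_Youngs_inequality:
  fixes g m p r X Y :: real
  assumes "1 < p" "0 < r" "0 \<le> X" "0 \<le> Y" "0 \<le> g"
  shows "p * g * X powr (p - 1) * Y
    \<le> r powr ((p - 1) * (1 - m)) * Y powr p + (p - 1) * r powr (m - 1) * g powr (p / (p - 1)) * X powr p"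
proof -
  \<comment> \<open>The weight is divided between the factors so that \<open>r powr (e * p)\<close>
    is the radial weight and \<open>r powr (- e * (p / (p - 1)))\<close> is the
    \<open>r powr (m - 1)\<close> of the Riccati inequality.\<close>
  define e where "e = (p - 1) * (1 - m) / p"
  define a where "a = r powr e * Y"
  define b where "b = g * r powr (- e) * X powr (p - 1)"
  have "a * b \<le> a powr p / p + b powr (p / (p - 1)) / (p / (p - 1))"
    by (rule Youngs_inequality) (use assms in \<open>auto simp: a_def b_def field_simps\<close>)
  then have "p * (a * b) \<le> p * (a powr p / p + b powr (p / (p - 1)) / (p / (p - 1)))"
    using assms by (intro mult_left_mono) auto
  also have "\<dots> = a powr p + (p - 1) * b powr (p / (p - 1))"
    using assms by (simp add: field_simps)
  also have "a powr p = r powr ((p - 1) * (1 - m)) * Y powr p"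
    using assms by (simp add: a_def e_def powr_mult powr_powr)
  also have "b powr (p / (p - 1)) = g powr (p / (p - 1)) * r powr (m - 1) * X powr p"
  proof -
    have "- e * (p / (p - 1)) = m - 1" "(p - 1) * (p / (p - 1)) = p"
      using assms by (simp_all add: e_def field_simps)
    then show ?thesis unfolding b_def using assms by (simp only: powr_mult powr_powr)
  qed
  also have "a * b = g * X powr (p - 1) * Y" using assms by (simp add: a_def b_def powr_minus)
  finally show ?thesis by (simp add: mult_ac)
qed

text \<open>\<open>\<Psi> = G |v|^p + I\<close> is nondecreasing on \<open>(0, 1)\<close>. It equals
  \<open>I\<close> at \<open>t0\<close>, where \<open>v\<close> vanishes, and is at least
  \<open>I\<close> near 0 because \<open>G \<ge> 0\<close>; letting the lower end tend to 0 gives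
  the claim. As the \<open>G\<close> constructed above blows up at 1, the integration stops at
  \<open>t0 < 1\<close>.\<close>

lemma radial_inequality:
  fixes G G' v v' :: "real \<Rightarrow> real"
  assumes p: "1 < p" and m: "m < 1"
    and G: "\<And>r. 0 < r \<Longrightarrow> r < 1 \<Longrightarrow> 0 \<le> G r"
      "\<And>r. 0 < r \<Longrightarrow> r < 1 \<Longrightarrow> (G has_real_derivative G' r) (at r)"
      "\<And>r. 0 < r \<Longrightarrow> r < 1 \<Longrightarrow>
         (p - 1) * r powr (m - 1) * G r powr (p / (p - 1)) + \<Lambda> * r powr ((p - 1) * (1 - m)) \<le> G' r"
    and v: "\<And>t. (v has_real_derivative v' t) (at t)" "continuous_on UNIV v'"
    and t0: "0 < t0" "t0 < 1" "v t0 = 0"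
  shows "0 \<le> integral {0..t0} (\<lambda>t. t powr ((p - 1) * (1 - m)) * (\<bar>v' t\<bar> powr p - \<Lambda> * \<bar>v t\<bar> powr p))"
proof -
  define f where "f t = t powr ((p - 1) * (1 - m)) * (\<bar>v' t\<bar> powr p - \<Lambda> * \<bar>v t\<bar> powr p)" for t
  define I where "I t = integral {0..t} f" for t
  have contv: "continuous_on UNIV v"
    using v(1) by (meson DERIV_isCont continuous_at_imp_continuous_on)
  have cont: "continuous_on {0..1} f"
    unfolding f_def using p m
    by (auto intro!: continuous_intros continuous_on_powr' continuous_on_subset[OF contv] continuous_on_subset[OF v(2)])
  have I': "(I has_real_derivative f t) (at t)" if "0 < t" "t < 1" for t
  proof -
    have "(I has_real_derivative f t) (at t within {0..1})"
      unfolding I_def using cont that by (intro integral_has_real_derivative) auto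
    moreover have "at t within {0..1} = at t" using that by (intro at_within_interior) simp
    ultimately show ?thesis by simp
  qed
  define \<Psi> where "\<Psi> t = G t * \<bar>v t\<bar> powr p + I t" for t
  have *: "\<exists>y. (\<Psi> has_real_derivative y) (at t) \<and> 0 \<le> y" if t: "0 < t" "t < 1" for t
  proof (intro exI conjI)
    have "((\<lambda>t. \<bar>v t\<bar> powr p) has_real_derivative p * \<bar>v t\<bar> powr (p - 1) * sgn (v t) * v' t) (at t)"
      by (rule DERIV_chain2[OF has_real_derivative_abs_powr[OF p] v(1)])
    then show "(\<Psi> has_real_derivative G' t * \<bar>v t\<bar> powr p
        + p * \<bar>v t\<bar> powr (p - 1) * sgn (v t) * v' t * G t + f t) (at t)"
      unfolding \<Psi>_def by (intro DERIV_add DERIV_mult G(2) I' t)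
    \<comment> \<open>Even with the worst sign of \<open>v v'\<close>, Young's inequality bounds the
      cross term by the \<open>|v'|^p\<close> part of \<open>f\<close> plus a multiple of
      \<open>|v|^p\<close>. That multiple and the \<open>\<Lambda>\<close> part of \<open>f\<close>
      are paid for by \<open>G'\<close>.\<close>
    have "- (\<bar>v' t\<bar>) \<le> sgn (v t) * v' t" by (auto simp: sgn_if)
    then have "p * G t * \<bar>v t\<bar> powr (p - 1) * (- \<bar>v' t\<bar>) \<le> p * G t * \<bar>v t\<bar> powr (p - 1) * (sgn (v t) * v' t)"
      using G(1)[OF t] p by (intro mult_left_mono) auto
    moreover have "p * G t * \<bar>v t\<bar> powr (p - 1) * \<bar>v' t\<bar>
        \<le> t powr ((p - 1) * (1 - m)) * \<bar>v' t\<bar> powr p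
          + (p - 1) * t powr (m - 1) * G t powr (p / (p - 1)) * \<bar>v t\<bar> powr p"
      using G(1)[OF t] p t by (intro weighted_Youngs_inequality) auto
    moreover have "((p - 1) * t powr (m - 1) * G t powr (p / (p - 1)) + \<Lambda> * t powr ((p - 1) * (1 - m))) * \<bar>v t\<bar> powr p
        \<le> G' t * \<bar>v t\<bar> powr p"
      by (intro mult_right_mono G(3) t) auto
    ultimately show "0 \<le> G' t * \<bar>v t\<bar> powr p + p * \<bar>v t\<bar> powr (p - 1) * sgn (v t) * v' t * G t + f t"
      unfolding f_def by (simp add: algebra_simps)
  qed
  have mono: "\<Psi> \<epsilon> \<le> \<Psi> t0" if "0 < \<epsilon>" "\<epsilon> < t0" for \<epsilon>
  proof (rule DERIV_nonneg_imp_nondecreasing[of \<epsilon> t0 \<Psi>])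
    fix t assume "\<epsilon> \<le> t" "t \<le> t0"
    with that t0 have "0 < t" "t < 1" by simp_all
    then show "\<exists>y. (\<Psi> has_real_derivative y) (at t) \<and> 0 \<le> y" by (rule *)
  qed (use that in simp)
  have "I \<epsilon> \<le> I t0" if "0 < \<epsilon>" "\<epsilon> < t0" for \<epsilon>
  proof -
    have "0 \<le> G \<epsilon> * \<bar>v \<epsilon>\<bar> powr p" using that t0 by (simp add: G(1))
    then show ?thesis using mono[OF that] t0 p by (simp add: \<Psi>_def)
  qed
  then have ev: "\<forall>\<^sub>F \<epsilon> in at_right 0. I \<epsilon> \<le> I t0"
    using t0 by (auto simp: eventually_at_right intro!: exI[of _ t0])
  have "continuous_on {0..1} I"
    unfolding I_def by (intro indefinite_integral_continuous_1 integrable_continuous_real cont)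
  then have "(I \<longlongrightarrow> I 0) (at 0 within {0..1})" by (simp add: continuous_on_def)
  then have "(I \<longlongrightarrow> I 0) (at_right 0)" by (simp add: at_within_Icc_at_right)
  then have "I 0 \<le> I t0" by (rule tendsto_upperbound[OF _ ev]) simp
  then show ?thesis by (simp add: I_def f_def[abs_def])
qed

text \<open>The ray inequality in \<open>ennreal\<close> and on the half-line, the form needed for
  Fubini's theorem. Here \<open>k\<close> stands for the dimension minus one.\<close>

lemma radial_inequality_nn_integral:
  fixes G G' v v' :: "real \<Rightarrow> real"
  assumes p: "1 < p" and m: "m < 1"
    and G: "\<And>r. 0 < r \<Longrightarrow> r < 1 \<Longrightarrow> 0 \<le> G r"
      "\<And>r. 0 < r \<Longrightarrow> r < 1 \<Longrightarrow> (G has_real_derivative G' r) (at r)"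
      "\<And>r. 0 < r \<Longrightarrow> r < 1 \<Longrightarrow>
         (p - 1) * r powr (m - 1) * G r powr (p / (p - 1)) + \<Lambda> * r powr ((p - 1) * (1 - m)) \<le> G' r"
    and v: "\<And>t. (v has_real_derivative v' t) (at t)" "continuous_on UNIV v'"
    and t0: "0 < t0" "t0 < 1" "\<And>t. t0 \<le> t \<Longrightarrow> v t = 0"
    and \<Lambda>: "0 \<le> \<Lambda>" and k: "real k = (p - 1) * (1 - m)"
  shows "(\<integral>\<^sup>+t. ennreal (\<Lambda> * \<bar>v t\<bar> powr p) * (ennreal (t ^ k) * indicator {0<..} t) \<partial>lborel)
    \<le> (\<integral>\<^sup>+t. ennreal (\<bar>v' t\<bar> powr p) * (ennreal (t ^ k) * indicator {0<..} t) \<partial>lborel)"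
proof -
  let ?f = "\<lambda>t. t powr real k * (\<Lambda> * \<bar>v t\<bar> powr p)" and ?g = "\<lambda>t. t powr real k * \<bar>v' t\<bar> powr p"
  have k0: "0 < real k" using k p m by simp
  have contv: "continuous_on UNIV v"
    using v(1) by (meson DERIV_isCont continuous_at_imp_continuous_on)
  have [measurable]: "v \<in> borel_measurable borel" "v' \<in> borel_measurable borel"
    using contv v(2) by (auto intro: borel_measurable_continuous_onI)
  have cont: "continuous_on {0..t0} ?f" "continuous_on {0..t0} ?g"
    using p k0 by (auto intro!: continuous_intros continuous_on_powr' continuous_on_subset[OF contv] continuous_on_subset[OF v(2)])
  have int: "?f integrable_on {0..t0}" "?g integrable_on {0..t0}"
    using cont by (auto intro: integrable_continuous_real)
  have restrict: "((\<lambda>x. indicator {0..t0} x * f x) has_integral integral {0..t0} f) UNIV"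
    if "f integrable_on {0..t0}" for f :: "real \<Rightarrow> real"
  proof -
    have "(\<lambda>x. indicator {0..t0} x * f x) = (\<lambda>x. if x \<in> {0..t0} then f x else 0)" by auto
    then show ?thesis using integrable_integral[OF that] by (simp only: has_integral_restrict_UNIV)
  qed
  have "0 \<le> integral {0..t0} (\<lambda>t. t powr real k * (\<bar>v' t\<bar> powr p - \<Lambda> * \<bar>v t\<bar> powr p))"
    unfolding k by (rule radial_inequality[OF p m G v t0(1,2)]) (use t0 in auto)
  also have "\<dots> = integral {0..t0} ?g - integral {0..t0} ?f"
    using int by (simp add: right_diff_distrib integral_diff)
  finally have le: "integral {0..t0} ?f \<le> integral {0..t0} ?g" by simp
  have "(\<integral>\<^sup>+t. ennreal (\<Lambda> * \<bar>v t\<bar> powr p) * (ennreal (t ^ k) * indicator {0<..} t) \<partial>lborel)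
     \<le> (\<integral>\<^sup>+t. indicator {0..t0} t * ?f t \<partial>lborel)"
  proof (rule nn_integral_mono)
    fix t show "ennreal (\<Lambda> * \<bar>v t\<bar> powr p) * (ennreal (t ^ k) * indicator {0<..} t) \<le> indicator {0..t0} t * ?f t"
      using \<Lambda> t0(3)[of t] p
      by (cases "t0 \<le> t") (auto simp: indicator_def powr_realpow ennreal_mult[symmetric] mult_ac)
  qed
  also have "\<dots> = integral {0..t0} ?f"
    using \<Lambda> by (intro nn_integral_has_integral_lborel restrict int) auto
  also have "\<dots> \<le> integral {0..t0} ?g" using le by (rule ennreal_leI)
  also have "\<dots> = (\<integral>\<^sup>+t. indicator {0..t0} t * ?g t \<partial>lborel)"
    by (intro nn_integral_has_integral_lborel[symmetric] restrict int) auto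
  also have "\<dots> \<le> (\<integral>\<^sup>+t. ennreal (\<bar>v' t\<bar> powr p) * (ennreal (t ^ k) * indicator {0<..} t) \<partial>lborel)"
  proof (rule nn_integral_mono)
    fix t show "indicator {0..t0} t * ?g t \<le> ennreal (\<bar>v' t\<bar> powr p) * (ennreal (t ^ k) * indicator {0<..} t)"
      using k0 by (cases "t = 0") (auto simp: indicator_def powr_realpow ennreal_mult[symmetric] mult_ac)
  qed
  finally show ?thesis .
qed

section \<open>Integration over rays\<close>

lemma nn_integral_scaleR:
  fixes h :: "'a::euclidean_space \<Rightarrow> ennreal"
  assumes [measurable]: "h \<in> borel_measurable borel" and "0 < t"
  shows "(\<integral>\<^sup>+x. h x \<partial>lborel) = ennreal (t ^ DIM('a)) * (\<integral>\<^sup>+y. h (t *\<^sub>R y) \<partial>lborel)"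
proof -
  have "(\<integral>\<^sup>+x. h x \<partial>lborel) = (\<integral>\<^sup>+x. h x \<partial>density (distr lborel borel (\<lambda>x. 0 + t *\<^sub>R x)) (\<lambda>_. \<bar>t\<bar> ^ DIM('a)))"
    using assms(2) by (subst lborel_affine[of t 0]) auto
  also have "\<dots> = ennreal (t ^ DIM('a)) * (\<integral>\<^sup>+y. h (t *\<^sub>R y) \<partial>lborel)"
    using assms(2) by (simp add: nn_integral_density nn_integral_distr nn_integral_cmult)
  finally show ?thesis .
qed

text \<open>A substitute for polar coordinates: averaging a ray integral over the annulus
  \<open>1 \<le> |y| \<le> 2\<close> instead of the unit sphere.\<close>
lemma nn_integral_rays:
  fixes h :: "'a::euclidean_space \<Rightarrow> ennreal"
  assumes [measurable]: "h \<in> borel_measurable borel"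
  shows "(\<integral>\<^sup>+y. indicator {y. 1 \<le> norm y \<and> norm y \<le> 2} y *
      (\<integral>\<^sup>+t. h (t *\<^sub>R y) * (ennreal (t ^ (DIM('a) - 1)) * indicator {0<..} t) \<partial>lborel) \<partial>lborel)
    = ennreal (ln 2) * (\<integral>\<^sup>+x. h x \<partial>lborel)"
proof -
  define A where "A = {y::'a. 1 \<le> norm y \<and> norm y \<le> 2}"
  have [measurable]: "A \<in> sets borel" unfolding A_def by measurable
  let ?w = "\<lambda>t. ennreal (t ^ (DIM('a) - 1)) * indicator {0<..} t :: ennreal"
  have "(\<integral>\<^sup>+y. indicator A y * (\<integral>\<^sup>+t. h (t *\<^sub>R y) * ?w t \<partial>lborel) \<partial>lborel)
      = (\<integral>\<^sup>+y. (\<integral>\<^sup>+t. indicator A y * (h (t *\<^sub>R y) * ?w t) \<partial>lborel) \<partial>lborel)"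
    by (intro nn_integral_cong nn_integral_cmult[symmetric]) simp
  also have "\<dots> = (\<integral>\<^sup>+t. (\<integral>\<^sup>+y. indicator A y * (h (t *\<^sub>R y) * ?w t) \<partial>lborel) \<partial>lborel)"
    by (rule lborel_pair.Fubini'[symmetric]) simp
  \<comment> \<open>For fixed \<open>t > 0\<close> the substitution \<open>x = t y\<close> turns
    \<open>t^(n - 1) dy\<close> into \<open>dx / t\<close>, where \<open>n\<close> is the
    dimension.\<close>
  also have "\<dots> = (\<integral>\<^sup>+t. (\<integral>\<^sup>+x. h x * (indicator A (x /\<^sub>R t) * (ennreal (1 / t) * indicator {0<..} t)) \<partial>lborel) \<partial>lborel)"
  proof (rule nn_integral_cong)
    fix t :: real
    show "(\<integral>\<^sup>+y. indicator A y * (h (t *\<^sub>R y) * ?w t) \<partial>lborel)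
        = (\<integral>\<^sup>+x. h x * (indicator A (x /\<^sub>R t) * (ennreal (1 / t) * indicator {0<..} t)) \<partial>lborel)"
    proof (cases "0 < t")
      case True
      have D: "t ^ DIM('a) = t ^ (DIM('a) - 1) * t"
        by (metis DIM_positive power_minus_mult)
      have "(\<integral>\<^sup>+x. h x * (indicator A (x /\<^sub>R t) * ennreal (1 / t)) \<partial>lborel)
         = ennreal (t ^ DIM('a)) * (\<integral>\<^sup>+y. h (t *\<^sub>R y) * (indicator A y * ennreal (1 / t)) \<partial>lborel)"
        using True by (subst nn_integral_scaleR[OF _ True]) auto
      also have "\<dots> = (\<integral>\<^sup>+y. ennreal (t ^ DIM('a)) * (h (t *\<^sub>R y) * (indicator A y * ennreal (1 / t))) \<partial>lborel)"
        by (rule nn_integral_cmult[symmetric]) simp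
      also have "\<dots> = (\<integral>\<^sup>+y. indicator A y * (h (t *\<^sub>R y) * ?w t) \<partial>lborel)"
      proof (rule nn_integral_cong)
        fix y
        have "ennreal (t ^ DIM('a)) * ennreal (1 / t) = ennreal (t ^ (DIM('a) - 1))"
          using True by (simp add: D ennreal_mult[symmetric])
        then show "ennreal (t ^ DIM('a)) * (h (t *\<^sub>R y) * (indicator A y * ennreal (1 / t))) = indicator A y * (h (t *\<^sub>R y) * ?w t)"
          using True by (simp add: mult_ac) (metis mult.assoc mult.commute)
      qed
      finally show ?thesis using True by simp
    qed simp
  qed
  also have "\<dots> = (\<integral>\<^sup>+x. (\<integral>\<^sup>+t. h x * (indicator A (x /\<^sub>R t) * (ennreal (1 / t) * indicator {0<..} t)) \<partial>lborel) \<partial>lborel)"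
    by (rule lborel_pair.Fubini') simp
  also have "\<dots> = (\<integral>\<^sup>+x. h x * ennreal (ln 2) \<partial>lborel)"
  proof (rule nn_integral_cong_AE)
    have "AE x in lborel. x \<noteq> (0::'a)" by (rule AE_lborel_singleton)
    then show "AE x in lborel. (\<integral>\<^sup>+t. h x * (indicator A (x /\<^sub>R t) * (ennreal (1 / t) * indicator {0<..} t)) \<partial>lborel)
        = h x * ennreal (ln 2)"
    proof (eventually_elim)
      fix x :: 'a assume x: "x \<noteq> 0"
      \<comment> \<open>\<open>x / t\<close> lies in the annulus exactly for \<open>t\<close>
        between \<open>|x| / 2\<close> and \<open>|x|\<close>, and \<open>dt / t\<close> gives this
        interval the mass \<open>ln 2\<close>, whatever \<open>x\<close> is.\<close>
      have "(\<integral>\<^sup>+t. indicator A (x /\<^sub>R t) * (ennreal (1 / t) * indicator {0<..} t) \<partial>lborel)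
          = (\<integral>\<^sup>+t. ennreal (1 / t) * indicator {norm x / 2..norm x} t \<partial>lborel)"
      proof (rule nn_integral_cong)
        fix t :: real
        show "indicator A (x /\<^sub>R t) * (ennreal (1 / t) * indicator {0<..} t) = ennreal (1 / t) * indicator {norm x / 2..norm x} t"
        proof (cases "0 < t")
          case True
          then have "x /\<^sub>R t \<in> A \<longleftrightarrow> t \<in> {norm x / 2..norm x}" by (auto simp: A_def field_simps)
          then show ?thesis using True by (simp add: indicator_def)
        next
          case False
          then have "t \<notin> {norm x / 2..norm x}" using x by (smt (verit) atLeastAtMost_iff half_gt_zero zero_less_norm_iff)
          then show ?thesis using False by simp
        qed
      qed
      also have "\<dots> = ennreal (ln (norm x) - ln (norm x / 2))"
      proof (rule nn_integral_FTC_Icc)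
        fix t assume "t \<in> {norm x / 2..norm x}"
        then have "0 < t" using x by (smt (verit) atLeastAtMost_iff half_gt_zero zero_less_norm_iff)
        then show "0 \<le> 1 / t" "(ln has_real_derivative 1 / t) (at t)"
          by (auto intro: DERIV_ln_divide)
      qed auto
      also have "ln (norm x) - ln (norm x / 2) = ln 2" using x by (simp add: ln_div)
      finally have "(\<integral>\<^sup>+t. indicator A (x /\<^sub>R t) * (ennreal (1 / t) * indicator {0<..} t) \<partial>lborel) = ennreal (ln 2)" .
      moreover have "(\<integral>\<^sup>+t. h x * (indicator A (x /\<^sub>R t) * (ennreal (1 / t) * indicator {0<..} t)) \<partial>lborel)
          = h x * (\<integral>\<^sup>+t. indicator A (x /\<^sub>R t) * (ennreal (1 / t) * indicator {0<..} t) \<partial>lborel)"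
        by (rule nn_integral_cmult) simp
      ultimately show "(\<integral>\<^sup>+t. h x * (indicator A (x /\<^sub>R t) * (ennreal (1 / t) * indicator {0<..} t)) \<partial>lborel)
        = h x * ennreal (ln 2)" by simp
    qed
  qed
  also have "\<dots> = ennreal (ln 2) * (\<integral>\<^sup>+x. h x \<partial>lborel)"
    by (simp add: nn_integral_multc mult.commute)
  finally show ?thesis unfolding A_def .
qed

text \<open>The ray integrals are homogeneous: passing from \<open>y\<close> to its positive
  multiple of norm \<open>R\<close> changes both by the same factor \<open>(R / |y|)^n\<close>, with
  \<open>n\<close> the dimension. The hypothesis on the sphere thus covers every ray through the
  annulus, and \<open>ln 2\<close> cancels.\<close>

lemma nn_integral_mono_rays:
  fixes f g :: "'a::euclidean_space \<Rightarrow> ennreal"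
  assumes [measurable]: "f \<in> borel_measurable borel" "g \<in> borel_measurable borel" and R: "0 < R"
    and le: "\<And>\<omega>. norm \<omega> = R \<Longrightarrow>
      (\<integral>\<^sup>+t. f (t *\<^sub>R \<omega>) * (ennreal (t ^ (DIM('a) - 1)) * indicator {0<..} t) \<partial>lborel)
      \<le> (\<integral>\<^sup>+t. g (t *\<^sub>R \<omega>) * (ennreal (t ^ (DIM('a) - 1)) * indicator {0<..} t) \<partial>lborel)"
  shows "(\<integral>\<^sup>+x. f x \<partial>lborel) \<le> (\<integral>\<^sup>+x. g x \<partial>lborel)"
proof -
  let ?w = "\<lambda>t. ennreal (t ^ (DIM('a) - 1)) * indicator {0<..} t :: ennreal"
  let ?A = "{y::'a. 1 \<le> norm y \<and> norm y \<le> 2}"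
  have scale: "(\<integral>\<^sup>+t. h (t *\<^sub>R y) * ?w t \<partial>lborel)
      = ennreal (R / norm y) * (ennreal ((R / norm y) ^ (DIM('a) - 1)) *
         (\<integral>\<^sup>+t. h (t *\<^sub>R ((R / norm y) *\<^sub>R y)) * ?w t \<partial>lborel))"
    if [measurable]: "h \<in> borel_measurable borel" and y: "y \<noteq> 0" for h :: "'a \<Rightarrow> ennreal" and y
  proof -
    define c where "c = R / norm y"
    have c: "0 < c" using R y by (simp add: c_def)
    have "(\<integral>\<^sup>+t. h (t *\<^sub>R y) * ?w t \<partial>lborel) = \<bar>c\<bar> * (\<integral>\<^sup>+t. h ((0 + c * t) *\<^sub>R y) * ?w (0 + c * t) \<partial>lborel)"
      using c by (intro nn_integral_real_affine) auto
    also have "(\<integral>\<^sup>+t. h ((0 + c * t) *\<^sub>R y) * ?w (0 + c * t) \<partial>lborel)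
        = (\<integral>\<^sup>+t. ennreal (c ^ (DIM('a) - 1)) * (h (t *\<^sub>R (c *\<^sub>R y)) * ?w t) \<partial>lborel)"
      using c by (intro nn_integral_cong)
        (auto simp: indicator_def power_mult_distrib ennreal_mult zero_less_mult_iff mult_ac)
    also have "\<dots> = ennreal (c ^ (DIM('a) - 1)) * (\<integral>\<^sup>+t. h (t *\<^sub>R (c *\<^sub>R y)) * ?w t \<partial>lborel)"
      by (rule nn_integral_cmult) simp
    finally show ?thesis unfolding abs_of_pos[OF c] by (simp only: c_def)
  qed
  have "ennreal (ln 2) * (\<integral>\<^sup>+x. f x \<partial>lborel) \<le> ennreal (ln 2) * (\<integral>\<^sup>+x. g x \<partial>lborel)"
    unfolding nn_integral_rays[OF assms(1), symmetric] nn_integral_rays[OF assms(2), symmetric]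
  proof (rule nn_integral_mono)
    fix y :: 'a
    show "indicator ?A y * (\<integral>\<^sup>+t. f (t *\<^sub>R y) * ?w t \<partial>lborel) \<le> indicator ?A y * (\<integral>\<^sup>+t. g (t *\<^sub>R y) * ?w t \<partial>lborel)"
    proof (cases "y = 0")
      case False
      then have "norm ((R / norm y) *\<^sub>R y) = R" using R by simp
      from le[OF this] show ?thesis
        unfolding scale[OF assms(1) False] scale[OF assms(2) False] by (intro mult_left_mono) auto
    qed simp
  qed
  then show ?thesis by (simp add: ennreal_mult_le_mult_iff)
qed

section \<open>Test functions and density\<close>

lemma C_1_has_derivative:
  fixes u :: "'a::euclidean_space \<Rightarrow> real"
  assumes "C_k 1 u"
  shows "(u has_derivative (\<lambda>h. gradient u x \<bullet> h)) (at x)"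
proof -
  let ?D = "frechet_derivative u (at x)"
  have D: "(u has_derivative ?D) (at x)"
    using assms by (simp flip: frechet_derivative_works)
  have "?D h = gradient u x \<bullet> h" for h
  proof -
    have "?D h = (\<Sum>i\<in>Basis. (h \<bullet> i) * ?D i)"
      using Linear_Algebra.linear_componentwise[OF has_derivative_linear[OF D], of h 1] by simp
    then show ?thesis by (simp add: gradient_def inner_sum_right inner_commute[of _ h] mult.commute)
  qed
  then have "?D = (\<lambda>h. gradient u x \<bullet> h)" by auto
  with D show ?thesis by simp
qed

lemma C_1_continuous:
  fixes u :: "'a::euclidean_space \<Rightarrow> real"
  assumes "C_k 1 u"
  shows "continuous_on UNIV u" "continuous_on UNIV (gradient u)"
proof -
  show "continuous_on UNIV u"
    using C_1_has_derivative[OF assms] by (meson continuous_at_imp_continuous_on has_derivative_continuous)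
  have "gradient u = (\<lambda>x. \<Sum>i\<in>Basis. frechet_derivative u (at x) i *\<^sub>R i)"
    by (simp add: gradient_def fun_eq_iff)
  then show "continuous_on UNIV (gradient u)"
    using assms by (auto intro!: continuous_intros)
qed

lemma gradient_eq_zero_outside_support:
  assumes "C_k 1 u" "x \<notin> closure {x. u x \<noteq> 0}"
  shows "gradient u x = 0"
proof -
  have "((\<lambda>_. 0) has_derivative (\<lambda>h. gradient u x \<bullet> h)) (at x)"
  proof (rule has_derivative_transform_within_open[OF C_1_has_derivative[OF assms(1)]])
    show "open (- closure {x. u x \<noteq> 0})" by auto
    show "y \<in> - closure {x. u x \<noteq> 0} \<Longrightarrow> u y = 0" for y
      using closure_subset[of "{x. u x \<noteq> 0}"] by auto
  qed (use assms in auto)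
  then have "(\<lambda>h. gradient u x \<bullet> h) = (\<lambda>h. 0)"
    by (rule has_derivative_unique) (rule has_derivative_const)
  then show ?thesis by (metis inner_eq_zero_iff)
qed

lemma test_functionD:
  assumes "test_function \<Omega> u"
  shows "C_k 1 u" "compact (closure {x. u x \<noteq> 0})" "closure {x. u x \<noteq> 0} \<subseteq> \<Omega>"
    "\<And>x. x \<notin> closure {x. u x \<noteq> 0} \<Longrightarrow> u x = 0"
  using assms closure_subset[of "{x. u x \<noteq> 0}"] by (auto simp: test_function_def)

text \<open>Links the measure \<open>lebesgue_on \<Omega>\<close> of the definitions with
  \<open>lborel\<close> on the whole space, where Fubini's theorem and translation invariance are
  applied.\<close>

lemma compact_support_integral:
  fixes f :: "'a::euclidean_space \<Rightarrow> real"
  assumes f: "continuous_on UNIV f" and K: "compact K" "K \<subseteq> \<Omega>" "\<And>x. x \<notin> K \<Longrightarrow> f x = 0"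
    and \<Omega>: "\<Omega> \<in> sets lebesgue"
  shows "integrable lborel f" "integrable (lebesgue_on \<Omega>) f"
    "(LINT x|lebesgue_on \<Omega>. f x) = (LINT x|lborel. f x)"
proof -
  have "(\<lambda>x. indicator K x * f x) = f" using K(3) by (auto simp: indicator_def fun_eq_iff)
  then show int: "integrable lborel f"
    using borel_integrable_compact[OF K(1) continuous_on_subset[OF f]] by simp
  have ind: "(\<lambda>x. indicator \<Omega> x *\<^sub>R f x) = f" using K(2,3) by (auto simp: indicator_def fun_eq_iff)
  have [measurable]: "f \<in> borel_measurable borel" using f by (rule borel_measurable_continuous_onI)
  have "integrable lebesgue f" using int by (simp add: integrable_completion)
  then show "integrable (lebesgue_on \<Omega>) f"
    using \<Omega> ind by (simp add: integrable_restrict_space)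
  show "(LINT x|lebesgue_on \<Omega>. f x) = (LINT x|lborel. f x)"
    using \<Omega> ind by (simp add: integral_restrict_space integral_completion)
qed

lemma test_function_integral:
  assumes "test_function \<Omega> u" "\<Omega> \<in> sets lebesgue" "0 < p"
  shows "integrable lborel (\<lambda>x. \<bar>u x\<bar> powr p)" "integrable (lebesgue_on \<Omega>) (\<lambda>x. \<bar>u x\<bar> powr p)"
    "(LINT x|lebesgue_on \<Omega>. \<bar>u x\<bar> powr p) = (LINT x|lborel. \<bar>u x\<bar> powr p)"
    "integrable lborel (\<lambda>x. norm (gradient u x) powr p)"
    "integrable (lebesgue_on \<Omega>) (\<lambda>x. norm (gradient u x) powr p)"
    "(LINT x|lebesgue_on \<Omega>. norm (gradient u x) powr p) = (LINT x|lborel. norm (gradient u x) powr p)"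
proof -
  note u = test_functionD[OF assms(1)]
  have 1: "continuous_on UNIV (\<lambda>x. \<bar>u x\<bar> powr p)"
    using assms(3) by (intro continuous_on_powr' continuous_intros C_1_continuous(1)[OF u(1)]) auto
  have 2: "continuous_on UNIV (\<lambda>x. norm (gradient u x) powr p)"
    using assms(3) by (intro continuous_on_powr' continuous_intros C_1_continuous(2)[OF u(1)]) auto
  have 3: "\<bar>u x\<bar> powr p = 0" if "x \<notin> closure {x. u x \<noteq> 0}" for x
    using u(4)[OF that] by simp
  have 4: "norm (gradient u x) powr p = 0" if "x \<notin> closure {x. u x \<noteq> 0}" for x
    using gradient_eq_zero_outside_support[OF u(1) that] by simp
  show "integrable lborel (\<lambda>x. \<bar>u x\<bar> powr p)" "integrable (lebesgue_on \<Omega>) (\<lambda>x. \<bar>u x\<bar> powr p)"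
    "(LINT x|lebesgue_on \<Omega>. \<bar>u x\<bar> powr p) = (LINT x|lborel. \<bar>u x\<bar> powr p)"
    by (rule compact_support_integral[OF 1 u(2,3) 3 assms(2)]; assumption)+
  show "integrable lborel (\<lambda>x. norm (gradient u x) powr p)"
    "integrable (lebesgue_on \<Omega>) (\<lambda>x. norm (gradient u x) powr p)"
    "(LINT x|lebesgue_on \<Omega>. norm (gradient u x) powr p) = (LINT x|lborel. norm (gradient u x) powr p)"
    by (rule compact_support_integral[OF 2 u(2,3) 4 assms(2)]; assumption)+
qed

text \<open>Keeps the support of a test function away from the sphere of radius \<open>R\<close>,
  which corresponds to the singularity of \<open>G\<close> at 1.\<close>

lemma compact_subset_ball_shrink:
  fixes K :: "'a::euclidean_space set"
  assumes "compact K" "K \<subseteq> ball 0 R" "0 < R"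
  obtains t where "0 < t" "t < 1" "K \<subseteq> ball 0 (t * R)"
proof (cases "K = {}")
  case True
  then show thesis using that[of "1/2"] by simp
next
  case False
  obtain x0 where x0: "x0 \<in> K" "\<And>x. x \<in> K \<Longrightarrow> norm x \<le> norm x0"
    using continuous_attains_sup[OF assms(1) False, of norm] continuous_on_norm_id by blast
  \<comment> \<open>The midpoint of \<open>|x0| / R\<close> and 1, where \<open>x0\<close> is a
    point of \<open>K\<close> farthest from the origin.\<close>
  define t where "t = (norm x0 / R + 1) / 2"
  have "norm x0 < R" using x0(1) assms(2) by auto
  then have "norm x0 < t * R" "t < 1" "0 < t"
    using assms(3) by (auto simp: t_def field_simps add_pos_nonneg)
  then show thesis using x0(2) by (intro that[of t]) fastforce+
qed

text \<open>For \<open>|\<omega>| = R\<close> the function \<open>v t = u (t \<omega>)\<close>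
  vanishes from some \<open>t0 < 1\<close> on, so the ray inequality on the unit interval applies.
  Cauchy-Schwarz gives \<open>|v'| \<le> R |\<nabla>u|\<close>, hence the factor
  \<open>R powr p\<close>.\<close>

lemma test_function_rayleigh_bound:
  fixes u :: "'a::euclidean_space \<Rightarrow> real" and G G' :: "real \<Rightarrow> real"
  assumes p: "1 < p" and m: "m < 1" and dim: "real (DIM('a) - 1) = (p - 1) * (1 - m)"
    and \<Lambda>: "0 \<le> \<Lambda>" and R: "0 < R"
    and G: "\<And>r. 0 < r \<Longrightarrow> r < 1 \<Longrightarrow> 0 \<le> G r"
      "\<And>r. 0 < r \<Longrightarrow> r < 1 \<Longrightarrow> (G has_real_derivative G' r) (at r)"
      "\<And>r. 0 < r \<Longrightarrow> r < 1 \<Longrightarrow>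
         (p - 1) * r powr (m - 1) * G r powr (p / (p - 1)) + \<Lambda> * r powr ((p - 1) * (1 - m)) \<le> G' r"
    and u: "test_function (ball 0 R) u"
  shows "\<Lambda> * (LINT x|lebesgue_on (ball 0 R). \<bar>u x\<bar> powr p)
    \<le> R powr p * (LINT x|lebesgue_on (ball 0 R). norm (gradient u x) powr p)"
proof -
  note tf = test_functionD[OF u]
  have p0: "0 < p" using p by simp
  have B: "ball (0::'a) R \<in> sets lebesgue" by simp
  note I = test_function_integral[OF u B p0]
  have [measurable]: "u \<in> borel_measurable borel" "gradient u \<in> borel_measurable borel"
    using C_1_continuous[OF tf(1)] by (auto intro: borel_measurable_continuous_onI)
  obtain t0 where t0: "0 < t0" "t0 < 1" "closure {x. u x \<noteq> 0} \<subseteq> ball 0 (t0 * R)"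
    using compact_subset_ball_shrink[OF tf(2,3) R] by blast
  have "(\<integral>\<^sup>+x. ennreal (\<Lambda> * \<bar>u x\<bar> powr p) \<partial>lborel) \<le> (\<integral>\<^sup>+x. ennreal (R powr p * norm (gradient u x) powr p) \<partial>lborel)"
  proof (rule nn_integral_mono_rays[OF _ _ R])
    fix \<omega> :: 'a assume \<omega>: "norm \<omega> = R"
    let ?w = "\<lambda>t. ennreal (t ^ (DIM('a) - 1)) * indicator {0<..} t :: ennreal"
    let ?v = "\<lambda>t. u (t *\<^sub>R \<omega>)" and ?v' = "\<lambda>t. gradient u (t *\<^sub>R \<omega>) \<bullet> \<omega>"
    have "(\<integral>\<^sup>+t. ennreal (\<Lambda> * \<bar>?v t\<bar> powr p) * ?w t \<partial>lborel) \<le> (\<integral>\<^sup>+t. ennreal (\<bar>?v' t\<bar> powr p) * ?w t \<partial>lborel)"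
    proof (rule radial_inequality_nn_integral[OF p m G])
      show "(?v has_real_derivative ?v' t) (at t)" for t
      proof -
        have "((\<lambda>t. t *\<^sub>R \<omega>) has_derivative (\<lambda>h. h *\<^sub>R \<omega>)) (at t)" by (auto intro!: derivative_eq_intros)
        from has_derivative_compose[OF this C_1_has_derivative[OF tf(1)]]
        show ?thesis by (simp add: has_field_derivative_def mult_commute_abs)
      qed
      show "continuous_on UNIV ?v'"
        by (intro continuous_intros continuous_on_compose2[OF C_1_continuous(2)[OF tf(1)]]) auto
      show "?v t = 0" if "t0 \<le> t" for t
      proof -
        have "t *\<^sub>R \<omega> \<notin> ball 0 (t0 * R)" using that t0 R \<omega> by (simp add: mult_right_mono)
        then show ?thesis using t0(3) tf(4) by blast
      qed
    qed (use t0 \<Lambda> dim in auto)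
    also have "\<dots> \<le> (\<integral>\<^sup>+t. ennreal (R powr p * norm (gradient u (t *\<^sub>R \<omega>)) powr p) * ?w t \<partial>lborel)"
    proof (intro nn_integral_mono mult_right_mono ennreal_leI)
      fix t
      have "\<bar>?v' t\<bar> powr p \<le> (norm (gradient u (t *\<^sub>R \<omega>)) * norm \<omega>) powr p"
        using p0 by (intro powr_mono2 Cauchy_Schwarz_ineq2) auto
      then show "\<bar>?v' t\<bar> powr p \<le> R powr p * norm (gradient u (t *\<^sub>R \<omega>)) powr p"
        using R by (simp add: \<omega> powr_mult mult.commute)
    qed auto
    finally show "(\<integral>\<^sup>+t. ennreal (\<Lambda> * \<bar>?v t\<bar> powr p) * ?w t \<partial>lborel)
      \<le> (\<integral>\<^sup>+t. ennreal (R powr p * norm (gradient u (t *\<^sub>R \<omega>)) powr p) * ?w t \<partial>lborel)" .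
  qed simp_all
  also have "(\<integral>\<^sup>+x. ennreal (\<Lambda> * \<bar>u x\<bar> powr p) \<partial>lborel) = ennreal (LINT x|lborel. \<Lambda> * \<bar>u x\<bar> powr p)"
    using I \<Lambda> by (intro nn_integral_eq_integral) auto
  also have "(\<integral>\<^sup>+x. ennreal (R powr p * norm (gradient u x) powr p) \<partial>lborel)
      = ennreal (LINT x|lborel. R powr p * norm (gradient u x) powr p)"
    using I by (intro nn_integral_eq_integral) auto
  finally have "(LINT x|lborel. \<Lambda> * \<bar>u x\<bar> powr p) \<le> (LINT x|lborel. R powr p * norm (gradient u x) powr p)"
    by (subst (asm) ennreal_le_iff) (auto intro!: integral_nonneg_AE)
  then show ?thesis unfolding I(3,6) by simp
qed

section \<open>From test functions to \<open>W1p_0\<close>\<close>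

text \<open>Convexity of the power at the points \<open>|a| / (1 - l)\<close> and
  \<open>|b| / l\<close> with weights \<open>1 - l\<close> and \<open>l\<close>. For small
  \<open>l\<close> the coefficient of \<open>a\<close> is close to 1, so that no constant is lost in
  the limit.\<close>

lemma norm_add_powr_le:
  fixes a b :: "'a::real_normed_vector" and l p :: real
  assumes "1 \<le> p" "0 < l" "l < 1"
  shows "norm (a + b) powr p \<le> (1 - l) powr (1 - p) * norm a powr p + l powr (1 - p) * norm b powr p"
proof -
  have ge1: "1 \<le> c powr (1 - p)" if "0 < c" "c < 1" for c :: real
    using powr_mono'[of "1 - p" 0 c] that assms(1) by simp
  have "(norm a + norm b) powr p \<le> (1 - l) powr (1 - p) * norm a powr p + l powr (1 - p) * norm b powr p"
  proof (cases "a = 0 \<or> b = 0")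
    case True
    then show ?thesis
      using mult_right_mono[OF ge1[of l], of "norm b powr p"]
        mult_right_mono[OF ge1[of "1 - l"], of "norm a powr p"] assms by auto
  next
    case False
    have "((1 - l) *\<^sub>R (norm a / (1 - l)) + l *\<^sub>R (norm b / l)) powr p
        \<le> (1 - l) * (norm a / (1 - l)) powr p + l * (norm b / l) powr p"
      by (rule convex_onD[OF powr_convex[OF assms(1)]]) (use assms False in auto)
    also have "(1 - l) * (norm a / (1 - l)) powr p = (1 - l) powr (1 - p) * norm a powr p"
      using assms by (simp add: powr_divide powr_diff)
    also have "l * (norm b / l) powr p = l powr (1 - p) * norm b powr p"
      using assms by (simp add: powr_divide powr_diff)
    finally show ?thesis using assms by simp
  qed
  moreover have "norm (a + b) powr p \<le> (norm a + norm b) powr p"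
    using assms by (intro powr_mono2 norm_triangle_ineq) auto
  ultimately show ?thesis by linarith
qed

lemma integrable_norm_diff_powr:
  fixes f g :: "'a \<Rightarrow> 'b::euclidean_space"
  assumes "1 \<le> p" and [measurable]: "f \<in> borel_measurable M" "g \<in> borel_measurable M"
    and "integrable M (\<lambda>x. norm (f x) powr p)" "integrable M (\<lambda>x. norm (g x) powr p)"
  shows "integrable M (\<lambda>x. norm (f x - g x) powr p)"
proof (rule Bochner_Integration.integrable_bound)
  show "integrable M (\<lambda>x. (1 - 1/2) powr (1 - p) * norm (f x) powr p + (1/2) powr (1 - p) * norm (- g x) powr p)"
    using assms by simp
  show "AE x in M. norm (norm (f x - g x) powr p)
      \<le> norm ((1 - 1/2) powr (1 - p) * norm (f x) powr p + (1/2) powr (1 - p) * norm (- g x) powr p)"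
    using norm_add_powr_le[OF assms(1), of "1/2" "f _" "- g _"] by (intro always_eventually) simp
qed simp

lemma integral_norm_powr_le:
  fixes f g :: "'a \<Rightarrow> 'b::euclidean_space"
  assumes p: "1 \<le> p" and [measurable]: "f \<in> borel_measurable M" "g \<in> borel_measurable M"
    and int: "integrable M (\<lambda>x. norm (f x) powr p)" "integrable M (\<lambda>x. norm (g x) powr p)"
    and l: "0 < l" "l < 1"
  shows "(LINT x|M. norm (g x) powr p) \<le> (1 - l) powr (1 - p) * (LINT x|M. norm (f x) powr p)
    + l powr (1 - p) * (LINT x|M. norm (f x - g x) powr p)"
proof -
  have i: "integrable M (\<lambda>x. norm (f x - g x) powr p)" by (rule integrable_norm_diff_powr) (use assms in auto)
  have "(LINT x|M. norm (g x) powr p) \<le> (LINT x|M. (1 - l) powr (1 - p) * norm (f x) powr p + l powr (1 - p) * norm (f x - g x) powr p)"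
  proof (rule integral_mono)
    fix x
    show "norm (g x) powr p \<le> (1 - l) powr (1 - p) * norm (f x) powr p + l powr (1 - p) * norm (f x - g x) powr p"
      using norm_add_powr_le[OF p l, of "f x" "- (f x - g x)"] by (simp add: norm_minus_commute)
  qed (use i int in auto)
  also have "\<dots> = (1 - l) powr (1 - p) * (LINT x|M. norm (f x) powr p)
    + l powr (1 - p) * (LINT x|M. norm (f x - g x) powr p)"
    using i int by simp
  finally show ?thesis .
qed

text \<open>The bound passes from the approximating test functions to \<open>u\<close>. The limit in
  \<open>k\<close> is taken first, for fixed \<open>l\<close>, since \<open>l powr (1 - p)\<close>
  is unbounded as \<open>l\<close> tends to 0.\<close>

lemma W1p_0_rayleigh_bound:
  fixes u :: "'a::euclidean_space \<Rightarrow> real"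
  assumes p: "1 < p" and \<Omega>: "\<Omega> \<in> sets lebesgue" and c: "0 \<le> c"
    and test: "\<And>\<phi>. test_function \<Omega> \<phi> \<Longrightarrow>
      c * (LINT x|lebesgue_on \<Omega>. \<bar>\<phi> x\<bar> powr p) \<le> (LINT x|lebesgue_on \<Omega>. norm (gradient \<phi> x) powr p)"
    and u: "W1p_0 p \<Omega> u g"
  shows "c * (LINT x|lebesgue_on \<Omega>. \<bar>u x\<bar> powr p) \<le> (LINT x|lebesgue_on \<Omega>. norm (g x) powr p)"
proof -
  let ?M = "lebesgue_on \<Omega>"
  have p1: "1 \<le> p" "0 < p" using p by auto
  have [measurable]: "u \<in> borel_measurable ?M" "g \<in> borel_measurable ?M"
    and iu: "integrable ?M (\<lambda>x. norm (u x) powr p)" and ig: "integrable ?M (\<lambda>x. norm (g x) powr p)"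
    using u by (auto simp: W1p_0_def W1p_def Lp_function_def)
  obtain \<phi> where \<phi>: "\<And>k::nat. test_function \<Omega> (\<phi> k)"
    and lim: "(\<lambda>k. LINT x|?M. norm (\<phi> k x - u x) powr p) \<longlonglongrightarrow> 0"
      "(\<lambda>k. LINT x|?M. norm (gradient (\<phi> k) x - g x) powr p) \<longlonglongrightarrow> 0"
    using u by (auto simp: W1p_0_def)
  have meas: "f \<in> borel_measurable ?M" if "continuous_on UNIV f" for f :: "'a \<Rightarrow> 'c::euclidean_space"
    using borel_measurable_continuous_onI[OF that] by (intro measurable_restrict_space1 measurable_completion) simp
  have m\<phi>: "\<phi> k \<in> borel_measurable ?M" "gradient (\<phi> k) \<in> borel_measurable ?M" for k
    using C_1_continuous[OF test_functionD(1)[OF \<phi>]] by (auto intro: meas)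
  note I = test_function_integral[OF \<phi> \<Omega> p1(2), folded real_norm_def]
  define U where "U = (LINT x|?M. norm (u x) powr p)"
  define V where "V = (LINT x|?M. norm (g x) powr p)"
  \<comment> \<open>The square arises because the comparison is used twice: from \<open>u\<close> to
    \<open>\<phi> k\<close>, and from \<open>gradient (\<phi> k)\<close> to
    \<open>g\<close>.\<close>
  have bound: "c * U \<le> ((1 - l) powr (1 - p))\<^sup>2 * V" if l: "0 < l" "l < 1" for l
  proof -
    define a where "a = (1 - l) powr (1 - p)"
    define b where "b = l powr (1 - p)"
    have ab: "0 \<le> a" "0 \<le> b" by (auto simp: a_def b_def)
    define d where "d k = (LINT x|?M. norm (\<phi> k x - u x) powr p)" for k
    define e where "e k = (LINT x|?M. norm (gradient (\<phi> k) x - g x) powr p)" for k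
    have "c * U \<le> a * (a * V + b * e k) + c * b * d k" for k
    proof -
      have "U \<le> a * (LINT x|?M. norm (\<phi> k x) powr p) + b * d k"
        unfolding U_def a_def b_def d_def
        by (rule integral_norm_powr_le) (use p1 m\<phi> I iu l in auto)
      then have "c * U \<le> c * (a * (LINT x|?M. norm (\<phi> k x) powr p) + b * d k)"
        using c by (rule mult_left_mono)
      also have "\<dots> = a * (c * (LINT x|?M. norm (\<phi> k x) powr p)) + c * b * d k"
        by (simp add: algebra_simps)
      also have "c * (LINT x|?M. norm (\<phi> k x) powr p) \<le> (LINT x|?M. norm (gradient (\<phi> k) x) powr p)"
        using test[OF \<phi>] by simp
      also have "(LINT x|?M. norm (gradient (\<phi> k) x) powr p)
          \<le> a * V + b * (LINT x|?M. norm (g x - gradient (\<phi> k) x) powr p)"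
        unfolding V_def a_def b_def
        by (rule integral_norm_powr_le) (use p1 m\<phi> I ig l in auto)
      finally show ?thesis using ab by (simp add: mult_left_mono e_def norm_minus_commute)
    qed
    moreover have "(\<lambda>k. a * (a * V + b * e k) + c * b * d k) \<longlonglongrightarrow> a * (a * V + b * 0) + c * b * 0"
      using lim unfolding d_def e_def by (intro tendsto_intros)
    ultimately have "c * U \<le> a * (a * V + b * 0) + c * b * 0"
      by (intro LIMSEQ_le_const) auto
    then show ?thesis by (simp add: a_def power2_eq_square)
  qed
  have "((\<lambda>l. ((1 - l) powr (1 - p))\<^sup>2 * V) \<longlongrightarrow> ((1 - 0) powr (1 - p))\<^sup>2 * V) (at_right 0)"
    by (intro tendsto_intros) auto
  moreover have "\<forall>\<^sub>F l in at_right (0::real). c * U \<le> ((1 - l) powr (1 - p))\<^sup>2 * V"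
    using bound by (intro eventually_at_rightI[of 0 1]) auto
  ultimately have "c * U \<le> ((1 - 0) powr (1 - p))\<^sup>2 * V"
    by (rule tendsto_lowerbound) simp
  then show ?thesis by (simp add: U_def V_def)
qed

section \<open>Smooth bumps and weak gradients\<close>

text \<open>For \<open>j = 0\<close> this is the classical flat function. The powers of
  \<open>1 / t\<close> make the family closed under differentiation up to linear
  combinations.\<close>

definition bump :: "nat \<Rightarrow> real \<Rightarrow> real" where
  "bump j t = (if t \<le> 0 then 0 else exp (- (1 / t)) / t ^ j)"

lemma bump_tendsto_0: "(bump j \<longlongrightarrow> 0) (at 0)"
proof -
  have "((\<lambda>s::real. s ^ j / exp s) \<longlongrightarrow> 0) at_top" by (rule tendsto_power_div_exp_0)
  then have "((\<lambda>t::real. inverse t ^ j / exp (inverse t)) \<longlongrightarrow> 0) (at_right 0)"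
    by (rule filterlim_compose[OF _ filterlim_inverse_at_top_right])
  then have "(bump j \<longlongrightarrow> 0) (at_right 0)"
    by (rule Lim_transform_eventually)
      (auto simp: bump_def exp_minus field_simps eventually_at_filter intro!: always_eventually)
  moreover have "(bump j \<longlongrightarrow> 0) (at_left 0)"
    by (rule Lim_transform_eventually[OF tendsto_const])
      (auto simp: bump_def eventually_at_filter intro!: always_eventually)
  ultimately show ?thesis by (simp add: filterlim_split_at)
qed

lemma has_real_derivative_bump:
  "(bump j has_real_derivative bump (j + 2) t - real j * bump (j + 1) t) (at t)"
proof -
  consider "t < 0" | "0 < t" | "t = 0" by linarith
  then show ?thesis
  proof cases
    case 1
    have "((\<lambda>_. 0) has_real_derivative bump (j + 2) t - real j * bump (j + 1) t) (at t)"
      using 1 by (simp add: bump_def)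
    then show ?thesis
      by (rule has_field_derivative_transform_within_open[where S = "{..<0}"]) (use 1 in \<open>auto simp: bump_def\<close>)
  next
    case 2
    \<comment> \<open>For \<open>j = 0\<close> the truncated exponent \<open>j - 1\<close> is
      harmless, as its term carries the factor \<open>real j\<close>.\<close>
    have "((\<lambda>t. exp (- (1 / t)) / t ^ j) has_real_derivative
        (exp (- (1 / t)) * (1 / (t * t)) * t ^ j - exp (- (1 / t)) * (real j * t ^ (j - 1))) / (t ^ j * t ^ j)) (at t)"
      using 2 by (auto intro!: derivative_eq_intros)
    also have "(exp (- (1 / t)) * (1 / (t * t)) * t ^ j - exp (- (1 / t)) * (real j * t ^ (j - 1))) / (t ^ j * t ^ j)
        = bump (j + 2) t - real j * bump (j + 1) t"
      using 2 by (cases j) (auto simp: bump_def field_simps power2_eq_square)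
    finally show ?thesis
      by (rule has_field_derivative_transform_within_open[where S = "{0<..}"]) (use 2 in \<open>auto simp: bump_def\<close>)
  next
    case 3
    have "((\<lambda>h. bump j h / h) \<longlongrightarrow> 0) (at 0)"
    \<comment> \<open>The difference quotient of \<open>bump j\<close> at 0 is
      \<open>bump (Suc j)\<close>, whose limit is already known to be 0.\<close>
    proof (rule Lim_transform_eventually[OF bump_tendsto_0[of "Suc j"]])
      show "\<forall>\<^sub>F h in at 0. bump (Suc j) h = bump j h / h"
        by (auto simp: bump_def eventually_at_filter intro!: always_eventually)
    qed
    then show ?thesis using 3 by (simp add: DERIV_def bump_def)
  qed
qed

text \<open>A class of functions on \<open>\<real>\<^sup>n\<close> that contains \<open>x \<mapsto> exp (-1 / (\<rho> - |x|\<^sup>2))\<close> and is closed under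
  directional derivatives; this gives smoothness without a product and chain rule for \<open>C_k\<close>.\<close>
inductive bump_class :: "real \<Rightarrow> ('a::euclidean_space \<Rightarrow> real) \<Rightarrow> bool" for \<rho> where
  base: "bump_class \<rho> (\<lambda>x. bump j (\<rho> - x \<bullet> x))"
| coord: "bump_class \<rho> w \<Longrightarrow> bump_class \<rho> (\<lambda>x. (x \<bullet> b) * w x)"
| scale: "bump_class \<rho> w \<Longrightarrow> bump_class \<rho> (\<lambda>x. c * w x)"
| add: "bump_class \<rho> w \<Longrightarrow> bump_class \<rho> w' \<Longrightarrow> bump_class \<rho> (\<lambda>x. w x + w' x)"

text \<open>One \<open>D\<close> serves all points, so each \<open>\<lambda>x. D x h\<close> is
  again a function in the class and the statement can be iterated to reach every order of
  smoothness.\<close>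

lemma bump_class_has_derivative:
  assumes "bump_class \<rho> w"
  shows "\<exists>D. (\<forall>x. (w has_derivative D x) (at x)) \<and> (\<forall>h. bump_class \<rho> (\<lambda>x. D x h))"
  using assms
proof induction
  case (base j)
  let ?D = "\<lambda>x h::'a. (- 2) * ((x \<bullet> h) * bump (j + 2) (\<rho> - x \<bullet> x)) + 2 * real j * ((x \<bullet> h) * bump (j + 1) (\<rho> - x \<bullet> x))"
  show ?case
  proof (intro exI[of _ ?D] conjI allI)
    fix x :: 'a
    have "((\<lambda>x. \<rho> - x \<bullet> x) has_derivative (\<lambda>h. - 2 * (x \<bullet> h))) (at x)"
      by (auto intro!: derivative_eq_intros simp: inner_commute)
    from has_derivative_compose[OF this has_real_derivative_bump[unfolded has_field_derivative_def]]
    show "((\<lambda>x. bump j (\<rho> - x \<bullet> x)) has_derivative ?D x) (at x)"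
      by (simp add: algebra_simps)
    show "bump_class \<rho> (\<lambda>x. ?D x h)" for h
      by (intro bump_class.intros)
  qed
next
  case (coord w b)
  then obtain D where D: "\<And>x. (w has_derivative D x) (at x)" "\<And>h. bump_class \<rho> (\<lambda>x. D x h)" by blast
  let ?D = "\<lambda>x h. (x \<bullet> b) * D x h + (h \<bullet> b) * w x"
  show ?case
  proof (intro exI[of _ ?D] conjI allI)
    show "((\<lambda>x. (x \<bullet> b) * w x) has_derivative ?D x) (at x)" for x
      using D(1) by (auto intro!: derivative_eq_intros)
    show "bump_class \<rho> (\<lambda>x. ?D x h)" for h
      by (intro bump_class.intros D coord)
  qed
next
  case (scale w c)
  then obtain D where D: "\<And>x. (w has_derivative D x) (at x)" "\<And>h. bump_class \<rho> (\<lambda>x. D x h)" by blast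
  show ?case
    by (rule exI[of _ "\<lambda>x h. c * D x h"]) (auto intro!: derivative_eq_intros bump_class.intros D)
next
  case (add w w')
  then obtain D D' where "\<And>x. (w has_derivative D x) (at x)" "\<And>h. bump_class \<rho> (\<lambda>x. D x h)"
    "\<And>x. (w' has_derivative D' x) (at x)" "\<And>h. bump_class \<rho> (\<lambda>x. D' x h)" by blast
  then show ?case
    by (intro exI[of _ "\<lambda>x h. D x h + D' x h"]) (auto intro!: derivative_eq_intros bump_class.intros)
qed

lemma bump_class_C_k: "bump_class \<rho> w \<Longrightarrow> C_k k w"
proof (induction k arbitrary: w)
  case 0
  then obtain D where "\<And>x. (w has_derivative D x) (at x)"
    using bump_class_has_derivative by blast
  then show ?case
    by (auto intro!: continuous_at_imp_continuous_on has_derivative_continuous)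
next
  case (Suc k)
  obtain D where D: "\<And>x. (w has_derivative D x) (at x)" "\<And>h. bump_class \<rho> (\<lambda>x. D x h)"
    using bump_class_has_derivative[OF Suc.prems] by blast
  have "frechet_derivative w (at x) = D x" for x
    using frechet_derivative_at[OF D(1)] by simp
  then show ?case using D Suc.IH by (auto simp: differentiable_def)
qed

text \<open>The function is \<open>exp (- 1 / (R^2 / 4 - |x|^2))\<close>, continued by 0. It serves
  to show that the infimum defining the eigenvalue is over a nonempty set.\<close>

lemma ex_test_function:
  assumes "0 < R"
  obtains u :: "'a::euclidean_space \<Rightarrow> real" and r
  where "test_function (ball 0 R) u" "0 < r" "r < R" "\<And>x. x \<in> ball 0 r \<Longrightarrow> u x \<noteq> 0"
proof
  let ?u = "\<lambda>x::'a. bump 0 ((R / 2)\<^sup>2 - x \<bullet> x)"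
  have iff: "?u x \<noteq> 0 \<longleftrightarrow> x \<in> ball 0 (R / 2)" for x
  proof -
    have "norm x < R / 2 \<longleftrightarrow> (norm x)\<^sup>2 < (R / 2)\<^sup>2" using power_strict_mono[of "norm x" "R / 2" 2] power_less_imp_less_base[of "norm x" 2 "R / 2"] assms by auto
    then show ?thesis by (auto simp: bump_def power2_norm_eq_inner)
  qed
  have set: "{x. ?u x \<noteq> 0} = ball 0 (R / 2)"
    by (intro set_eqI) (simp only: mem_Collect_eq iff)
  have "closure {x. ?u x \<noteq> 0} = cball 0 (R / 2)" unfolding set using assms by simp
  then show "test_function (ball 0 R) ?u"
    using assms bump_class_C_k[OF bump_class.base] by (auto simp: test_function_def)
  show "0 < R / 2" "R / 2 < R" using assms by auto
  show "?u x \<noteq> 0" if "x \<in> ball 0 (R / 2)" for x by (rule iffD2[OF iff that])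
qed

section \<open>Integration by parts\<close>

text \<open>Difference quotients of \<open>F\<close> in the direction \<open>i\<close> have integral
  0 by translation invariance and converge to the derivative. Dominated convergence applies: the
  mean value theorem bounds them by \<open>B\<close>, and they vanish outside one fixed
  ball.\<close>

lemma integral_directional_derivative_eq_0:
  fixes F :: "'a::euclidean_space \<Rightarrow> real"
  assumes F: "\<And>x. (F has_derivative F' x) (at x)" and cont: "continuous_on UNIV (\<lambda>x. F' x i)"
    and K: "compact K" "\<And>x. x \<notin> K \<Longrightarrow> F x = 0" "\<And>x. x \<notin> K \<Longrightarrow> F' x i = 0"
  shows "(LINT x|lborel. F' x i) = 0"
proof -
  have contF: "continuous_on UNIV F"
    using F by (meson continuous_at_imp_continuous_on has_derivative_continuous)
  have [measurable]: "F \<in> borel_measurable borel" "(\<lambda>x. F' x i) \<in> borel_measurable borel"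
    using contF cont by (auto intro: borel_measurable_continuous_onI)
  have intF: "integrable lborel F"
    by (rule compact_support_integral(1)[OF contF K(1) subset_UNIV K(2)]) auto
  obtain B where B: "\<And>x. \<bar>F' x i\<bar> \<le> B"
  proof -
    have "bounded ((\<lambda>x. F' x i) ` K)"
      by (intro compact_imp_bounded compact_continuous_image continuous_on_subset[OF cont] K) auto
    then obtain B where B: "\<And>x. x \<in> K \<Longrightarrow> \<bar>F' x i\<bar> \<le> B" by (auto simp: bounded_iff)
    \<comment> \<open>The maximum with 0 also covers the points outside \<open>K\<close>, where the
      derivative is 0.\<close>
    show thesis
    proof (rule that[of "max B 0"])
      show "\<bar>F' x i\<bar> \<le> max B 0" for x using B[of x] K(3)[of x] by (cases "x \<in> K") auto
    qed
  qed
  obtain C where C: "\<And>x. x \<in> K \<Longrightarrow> norm x \<le> C"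
    using compact_imp_bounded[OF K(1)] by (auto simp: bounded_iff)
  define e where "e k = 1 / real (Suc k)" for k
  have e: "0 < e k" "e k \<le> 1" for k by (auto simp: e_def)
  define s where "s k x = (F (x + e k *\<^sub>R i) - F x) / e k" for k x
  have line: "((\<lambda>t. F (x + t *\<^sub>R i)) has_real_derivative F' (x + t *\<^sub>R i) i) (at t)" for x t
  proof -
    have "((\<lambda>t. x + t *\<^sub>R i) has_derivative (\<lambda>h. h *\<^sub>R i)) (at t)" by (auto intro!: derivative_eq_intros)
    from has_derivative_compose[OF this F] has_derivative_linear[OF F]
    show ?thesis by (simp add: has_field_derivative_def linear_cmul mult_commute_abs)
  qed
  have "(LINT x|lborel. s k x) = 0" for k
  proof -
    let ?T = "distr lborel borel ((+) (e k *\<^sub>R i))"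
    have "integrable ?T F" by (simp only: lborel_distr_plus intF)
    then have "integrable lborel (\<lambda>x. F (x + e k *\<^sub>R i))"
      by (subst (asm) integrable_distr_eq) (auto simp: add.commute)
    moreover have "(LINT x|?T. F x) = (LINT x|lborel. F (x + e k *\<^sub>R i))"
      by (subst integral_distr) (auto simp: add.commute)
    then have "(LINT x|lborel. F (x + e k *\<^sub>R i)) = (LINT x|lborel. F x)"
      by (simp only: lborel_distr_plus)
    ultimately show ?thesis unfolding s_def using intF by simp
  qed
  moreover have "(\<lambda>k. LINT x|lborel. s k x) \<longlonglongrightarrow> (LINT x|lborel. F' x i)"
  proof (rule integral_dominated_convergence[where w = "\<lambda>x. B * indicator (cball 0 (C + norm i)) x"])
    show "s k \<in> borel_measurable lborel" for k unfolding s_def by measurable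
    show "integrable lborel (\<lambda>x. B * indicator (cball (0::'a) (C + norm i)) x)"
      by (intro integrable_mult_right integrable_real_indicator) (use emeasure_bounded_finite[OF bounded_cball] in auto)
    show "AE x in lborel. (\<lambda>k. s k x) \<longlonglongrightarrow> F' x i"
    proof (rule always_eventually, rule allI)
      fix x
      have "((\<lambda>h. (F (x + h *\<^sub>R i) - F x) / h) \<longlongrightarrow> F' x i) (at 0)"
        using line[of x 0] by (simp add: DERIV_def)
      moreover have "filterlim e (at 0) sequentially"
      proof -
        have "e = (\<lambda>k. inverse (real (Suc k)))" by (auto simp: e_def inverse_eq_divide)
        then have "e \<longlonglongrightarrow> 0" using LIMSEQ_inverse_real_of_nat by (simp only:)
        moreover have "e k \<noteq> 0" for k using e(1)[of k] by simp
        ultimately show ?thesis by (simp add: filterlim_at)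
      qed
      ultimately show "(\<lambda>k. s k x) \<longlonglongrightarrow> F' x i"
        unfolding s_def by (rule filterlim_compose)
    qed
    show "AE x in lborel. norm (s k x) \<le> B * indicator (cball 0 (C + norm i)) x" for k
    proof (rule always_eventually, rule allI)
      fix x
      have B0: "0 \<le> B" using B[of 0] by linarith
      show "norm (s k x) \<le> B * indicator (cball 0 (C + norm i)) x"
      proof (cases "x \<in> K \<or> x + e k *\<^sub>R i \<in> K")
        case True
        \<comment> \<open>A shift by \<open>e k *\<^sub>R i\<close> with \<open>e k \<le> 1\<close>
          moves a point by at most \<open>norm i\<close>.\<close>
        have "norm x \<le> C + norm i"
        proof (cases "x \<in> K")
          case False
          then have "norm (x + e k *\<^sub>R i) \<le> C" using True C by auto
          moreover have "norm (e k *\<^sub>R i) \<le> 1 * norm i" using e[of k] by (simp add: mult_left_le_one_le)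
          ultimately show ?thesis using norm_diff_ineq[of x "e k *\<^sub>R i"] by simp
        qed (use C[of x] norm_ge_zero[of i] in linarith)
        moreover obtain t where "F (x + e k *\<^sub>R i) - F (x + 0 *\<^sub>R i) = (e k - 0) * F' (x + t *\<^sub>R i) i"
          using MVT2[of 0 "e k" "\<lambda>t. F (x + t *\<^sub>R i)" "\<lambda>t. F' (x + t *\<^sub>R i) i"] e line by blast
        ultimately show ?thesis using B[of "x + t *\<^sub>R i"] e[of k] by (simp add: s_def)
      next
        case False
        then show ?thesis using K(2) B0 by (simp add: s_def)
      qed
    qed
  qed simp
  ultimately show ?thesis by (simp add: LIMSEQ_const_iff)
qed

lemma continuous_imp_locally_integrable:
  assumes "continuous_on UNIV f"
  shows "locally_integrable \<Omega> f"
  unfolding locally_integrable_def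
proof (intro allI impI)
  fix K assume K: "compact K \<and> K \<subseteq> \<Omega>"
  then obtain a b where ab: "K \<subseteq> cbox a b"
    using bounded_subset_cbox_symmetric compact_imp_bounded by metis
  have "f absolutely_integrable_on cbox a b"
    by (intro absolutely_integrable_continuous continuous_on_subset[OF assms]) auto
  then show "f absolutely_integrable_on K"
    by (rule set_integrable_subset) (use K ab in \<open>auto intro: lmeasurable_compact[THEN fmeasurableD]\<close>)
qed

text \<open>By the product rule both integrands add up to a directional derivative of
  \<open>u \<phi>\<close>, whose integral is 0.\<close>

lemma test_function_has_weak_gradient:
  assumes u: "test_function \<Omega> u" and \<Omega>: "\<Omega> \<in> sets lebesgue"
  shows "has_weak_gradient \<Omega> u (gradient u)"
  unfolding has_weak_gradient_def
proof (intro conjI allI impI ballI)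
  note U = test_functionD[OF u]
  show "locally_integrable \<Omega> u" "locally_integrable \<Omega> (gradient u)"
    using C_1_continuous[OF U(1)] by (auto intro: continuous_imp_locally_integrable)
  fix \<phi> i assume \<phi>: "test_function \<Omega> \<phi>"
  note P = test_functionD[OF \<phi>]
  let ?K = "closure {x. u x \<noteq> 0}"
  have 1: "continuous_on UNIV (\<lambda>x. u x * (gradient \<phi> x \<bullet> i))"
    and 2: "continuous_on UNIV (\<lambda>x. (gradient u x \<bullet> i) * \<phi> x)"
    by (intro continuous_intros C_1_continuous U(1) P(1))+
  have 3: "u x * (gradient \<phi> x \<bullet> i) = 0" if "x \<notin> ?K" for x using U(4)[OF that] by simp
  have 4: "(gradient u x \<bullet> i) * \<phi> x = 0" if "x \<notin> ?K" for x
    using gradient_eq_zero_outside_support[OF U(1) that] by simp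
  have I: "integrable lborel (\<lambda>x. u x * (gradient \<phi> x \<bullet> i))"
    "(LINT x|lebesgue_on \<Omega>. u x * (gradient \<phi> x \<bullet> i)) = (LINT x|lborel. u x * (gradient \<phi> x \<bullet> i))"
    by (rule compact_support_integral[OF 1 U(2,3) 3 \<Omega>]; assumption)+
  have J: "integrable lborel (\<lambda>x. (gradient u x \<bullet> i) * \<phi> x)"
    "(LINT x|lebesgue_on \<Omega>. (gradient u x \<bullet> i) * \<phi> x) = (LINT x|lborel. (gradient u x \<bullet> i) * \<phi> x)"
    by (rule compact_support_integral[OF 2 U(2,3) 4 \<Omega>]; assumption)+
  have "(LINT x|lborel. u x * (gradient \<phi> x \<bullet> i) + (gradient u x \<bullet> i) * \<phi> x) = 0"
  proof (rule integral_directional_derivative_eq_0[where K = ?K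
        and F = "\<lambda>x. u x * \<phi> x" and F' = "\<lambda>x h. u x * (gradient \<phi> x \<bullet> h) + (gradient u x \<bullet> h) * \<phi> x"])
    show "((\<lambda>x. u x * \<phi> x) has_derivative (\<lambda>h. u x * (gradient \<phi> x \<bullet> h) + (gradient u x \<bullet> h) * \<phi> x)) (at x)" for x
      by (intro has_derivative_mult C_1_has_derivative U(1) P(1))
    show "continuous_on UNIV (\<lambda>x. u x * (gradient \<phi> x \<bullet> i) + (gradient u x \<bullet> i) * \<phi> x)"
      using 1 2 by (rule continuous_on_add)
    show "u x * \<phi> x = 0" if "x \<notin> ?K" for x using U(4)[OF that] by simp
    show "u x * (gradient \<phi> x \<bullet> i) + (gradient u x \<bullet> i) * \<phi> x = 0" if "x \<notin> ?K" for x
      unfolding 3[OF that] 4[OF that] by simp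
  qed (rule U(2))
  then show "(LINT x|lebesgue_on \<Omega>. u x * (gradient \<phi> x \<bullet> i)) = - (LINT x|lebesgue_on \<Omega>. (gradient u x \<bullet> i) * \<phi> x)"
    unfolding I(2) J(2) using Bochner_Integration.integral_add[OF I(1) J(1)] by simp
qed

lemma test_function_W1p_0:
  assumes u: "test_function \<Omega> u" and \<Omega>: "\<Omega> \<in> sets lebesgue" and p: "0 < p"
  shows "W1p_0 p \<Omega> u (gradient u)"
proof -
  note U = test_functionD[OF u]
  have meas: "f \<in> borel_measurable (lebesgue_on \<Omega>)" if "continuous_on UNIV f" for f :: "'a \<Rightarrow> 'c::euclidean_space"
    using borel_measurable_continuous_onI[OF that] by (intro measurable_restrict_space1 measurable_completion) simp
  have "W1p p \<Omega> u (gradient u)"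
    using test_function_integral[OF u \<Omega> p] test_function_has_weak_gradient[OF u \<Omega>]
      C_1_continuous[OF U(1)]
    by (auto simp: W1p_def Lp_function_def intro: meas)
  \<comment> \<open>The constant sequence \<open>u\<close> is an approximating sequence.\<close>
  then show ?thesis using u by (auto simp: W1p_0_def intro!: exI[of _ "\<lambda>_. u"])
qed

section \<open>The eigenvalue of the ball\<close>

lemma p_laplace_eigenvalue_ball_ge:
  assumes p: "1 < p" and R: "0 < R" and c: "0 \<le> c"
    and test: "\<And>\<phi> :: 'a::euclidean_space \<Rightarrow> real. test_function (ball 0 R) \<phi> \<Longrightarrow>
      c * (LINT x|lebesgue_on (ball 0 R). \<bar>\<phi> x\<bar> powr p) \<le> (LINT x|lebesgue_on (ball 0 R). norm (gradient \<phi> x) powr p)"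
  shows "c \<le> p_laplace_eigenvalue p (ball (0::'a) R)"
  unfolding p_laplace_eigenvalue_def
proof (rule cInf_greatest)
  let ?M = "lebesgue_on (ball (0::'a) R)"
  have B: "ball (0::'a) R \<in> sets lebesgue" by simp
  obtain u :: "'a \<Rightarrow> real" and r where u: "test_function (ball 0 R) u" "0 < r" "r < R" "\<And>x. x \<in> ball 0 r \<Longrightarrow> u x \<noteq> 0"
    using ex_test_function[OF R] by blast
  \<comment> \<open>A lower bound passes to a real infimum only over a nonempty set. The bump is an
    admissible competitor, being nonzero on a ball of positive measure.\<close>
  have "\<not> (AE x in ?M. u x = 0)"
  proof
    assume "AE x in ?M. u x = 0"
    then have "AE x in lebesgue. x \<in> ball 0 R \<longrightarrow> u x = 0" by (simp add: AE_restrict_space_iff)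
    then have "AE x in lebesgue. x \<notin> ball (0::'a) r"
      by eventually_elim (use u(3,4) in force)
    then have "negligible (ball (0::'a) r)"
      by (simp add: negligible_iff_null_sets AE_iff_null_sets)
    then show False using open_not_negligible[of "ball (0::'a) r"] u(2) by simp
  qed
  then show "{(LINT x|?M. norm (g x) powr p) / (LINT x|?M. \<bar>u x\<bar> powr p) |u g. W1p_0 p (ball 0 R) u g \<and> \<not> (AE x in ?M. u x = 0)} \<noteq> {}"
    using test_function_W1p_0[OF u(1) B, of p] p by auto
  fix q assume "q \<in> {(LINT x|?M. norm (g x) powr p) / (LINT x|?M. \<bar>u x\<bar> powr p) |u g. W1p_0 p (ball 0 R) u g \<and> \<not> (AE x in ?M. u x = 0)}"
  then obtain u g where q: "q = (LINT x|?M. norm (g x) powr p) / (LINT x|?M. \<bar>u x\<bar> powr p)"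
    and u: "W1p_0 p (ball 0 R) u g" "\<not> (AE x in ?M. u x = 0)" by blast
  have iu: "integrable ?M (\<lambda>x. \<bar>u x\<bar> powr p)" using u(1) by (simp add: W1p_0_def W1p_def Lp_function_def)
  \<comment> \<open>Since \<open>u\<close> is not zero almost everywhere, the denominator is
    positive and the bound may be divided by it.\<close>
  have "(LINT x|?M. \<bar>u x\<bar> powr p) \<noteq> 0"
    using u(2) by (subst integral_nonneg_eq_0_iff_AE[OF iu]) auto
  moreover have "0 \<le> (LINT x|?M. \<bar>u x\<bar> powr p)" by (intro integral_nonneg_AE) auto
  ultimately have "0 < (LINT x|?M. \<bar>u x\<bar> powr p)" by argo
  then show "c \<le> q"
    using W1p_0_rayleigh_bound[OF p B c test u(1)] unfolding q by (simp add: pos_le_divide_eq)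
qed

theorem theorem6p3:
  fixes n :: nat and p m R s \<tau> :: real
  assumes "n = CARD('n::finite)" and "n \<ge> 2" and "p > real n" and "R > 0"
    and "m = (p - real n) / (p - 1)"
    and "s = sqrt ((5 * p - 7) / (3 * (p - 1)))"
    and "\<tau> = 1 - 4 * (1 - m) * (p * (1 + s - 2 * ln m) - 4 * m) powi (- 1)"
  shows "\<tau> \<in> {0<..<1} \<and>
    p_laplace_eigenvalue p (ball (0 :: real ^ 'n) R) \<ge>
      (1 / (p * R)) powr p *
      (((p - 1) powr (p - 1)) / ((real n - 1) powr (real n - 1))) powr (p / (p - real n)) *
      (1 + p / (4 * (p - 1)) * (1 + s - 2 * ln m - 2 * ln \<tau>) powi (- 2))"
proof -
  have n: "2 \<le> real n" using assms(2) by simp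
  have p: "2 < p" using n assms(3) by simp
  have m: "0 < m" "m < 1" using n p assms(3) by (auto simp: assms(5) field_simps)
  have m1: "1 - m = (real n - 1) / (p - 1)" using p by (simp add: assms(5) field_simps)
  \<comment> \<open>This amounts to \<open>p \<ge> 2\<close>. It yields
    \<open>1 + s \<ge> 2\<close>, as \<open>riccati_inequality\<close> asks of
    \<open>A\<close>.\<close>
  have "1 \<le> (5 * p - 7) / (3 * (p - 1))" using p by (simp add: field_simps)
  then have s: "1 \<le> s" unfolding assms(6) by simp
  have \<tau>: "0 < \<tau>" "\<tau> < 1"
  proof -
    define b where "b = 1 + s - 2 * ln m"
    have "ln m < 0" using m by simp
    then have "2 < b" using s by (simp add: b_def)
    then have "2 * 2 < p * b" using p by (intro mult_strict_mono) auto
    \<comment> \<open>Given the positive denominator, \<open>\<tau> > 0\<close> is equivalent to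
      \<open>p * b > 4\<close>, and both factors exceed 2.\<close>
    then have 1: "4 * (1 - m) < p * b - 4 * m" and 2: "0 < p * b - 4 * m" using m by (auto simp: algebra_simps)
    have "\<tau> = 1 - 4 * (1 - m) / (p * b - 4 * m)"
      by (simp add: assms(7) b_def power_int_minus divide_inverse)
    moreover have "4 * (1 - m) / (p * b - 4 * m) < 1" using 1 2 by (simp add: divide_less_eq)
    moreover have "0 < 4 * (1 - m) / (p * b - 4 * m)" using 2 m by simp
    ultimately show "0 < \<tau>" "\<tau> < 1" by linarith+
  qed
  \<comment> \<open>The bound for radius 1, with \<open>A = 1 + s\<close> and
    \<open>\<mu> = m * \<tau>\<close>, whose logarithm splits into the two logarithms of the
    claim.\<close>
  define \<Lambda> where "\<Lambda> = ((p - 1) / p) powr p * (1 - m) powr (- (p * (1 - m) / m))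
    * (1 + p / (4 * (p - 1)) / ((1 + s) - 2 * ln (m * \<tau>))\<^sup>2)"
  have \<mu>: "0 < m * \<tau>" "m * \<tau> \<le> m" using m \<tau> by (auto simp: mult_left_le)
  obtain G G' :: "real \<Rightarrow> real" where
    G: "\<And>r. 0 < r \<Longrightarrow> r < 1 \<Longrightarrow> 0 \<le> G r"
    "\<And>r. 0 < r \<Longrightarrow> r < 1 \<Longrightarrow> (G has_real_derivative G' r) (at r)"
    "\<And>r. 0 < r \<Longrightarrow> r < 1 \<Longrightarrow>
       (p - 1) * r powr (m - 1) * G r powr (p / (p - 1)) + \<Lambda> * r powr ((p - 1) * (1 - m)) \<le> G' r"
    using riccati_inequality[OF m _ \<mu>, of p "1 + s"] p s unfolding \<Lambda>_def by auto
  have \<Lambda>0: "0 \<le> \<Lambda>" unfolding \<Lambda>_def using p by (intro mult_nonneg_nonneg add_nonneg_nonneg) auto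
  have "R powr (- p) * \<Lambda> \<le> p_laplace_eigenvalue p (ball (0 :: real ^ 'n) R)"
  proof (rule p_laplace_eigenvalue_ball_ge)
    fix \<phi> :: "real ^ 'n \<Rightarrow> real" assume \<phi>: "test_function (ball 0 R) \<phi>"
    have "\<Lambda> * (LINT x|lebesgue_on (ball 0 R). \<bar>\<phi> x\<bar> powr p)
      \<le> R powr p * (LINT x|lebesgue_on (ball 0 R). norm (gradient \<phi> x) powr p)"
      by (rule test_function_rayleigh_bound[OF _ _ _ \<Lambda>0 assms(4) G \<phi>])
        (use p m m1 assms(1,2) in auto)
    then show "R powr (- p) * \<Lambda> * (LINT x|lebesgue_on (ball 0 R). \<bar>\<phi> x\<bar> powr p)
      \<le> (LINT x|lebesgue_on (ball 0 R). norm (gradient \<phi> x) powr p)"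
      using assms(4) by (simp add: powr_minus field_simps)
  qed (use p assms(4) \<Lambda>0 in auto)
  also have "R powr (- p) * \<Lambda> = (1 / (p * R)) powr p *
      (((p - 1) powr (p - 1)) / ((real n - 1) powr (real n - 1))) powr (p / (p - real n)) *
      (1 + p / (4 * (p - 1)) * (1 + s - 2 * ln m - 2 * ln \<tau>) powi (- 2))"
  proof -
    have "R powr (- p) * (((p - 1) / p) powr p * (1 - m) powr (- (p * (1 - m) / m)))
      = (1 / (p * R)) powr p * (((p - 1) powr (p - 1)) / ((real n - 1) powr (real n - 1))) powr (p / (p - real n))"
    proof -
      define k where "k = p / (p - real n)"
      \<comment> \<open>The first identity gives the power of \<open>n - 1\<close>. The second
        merges the powers of \<open>p - 1\<close> coming from \<open>((p - 1) / p) powr p\<close>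
        and from \<open>1 - m = (n - 1) / (p - 1)\<close>.\<close>
      have k: "p * (1 - m) / m = k * (real n - 1)" "p = k * (p - 1) - k * (real n - 1)"
      proof -
        have "(1 - m) / m = ((real n - 1) / (p - 1)) / ((p - real n) / (p - 1))"
          unfolding m1 by (simp only: assms(5))
        also have "\<dots> = (real n - 1) / (p - real n)" using p by simp
        finally have "(1 - m) / m = (real n - 1) / (p - real n)" .
        then show "p * (1 - m) / m = k * (real n - 1)" by (simp add: k_def flip: times_divide_eq_right)
        have "k * (p - real n) = p" using assms(3) by (simp add: k_def)
        then show "p = k * (p - 1) - k * (real n - 1)" by (simp add: algebra_simps)
      qed
      have "R powr (- p) * (((p - 1) / p) powr p * (1 - m) powr (- (p * (1 - m) / m)))
         = exp (- (p * ln R) + p * (ln (p - 1) - ln p) - k * (real n - 1) * (ln (real n - 1) - ln (p - 1)))"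
      proof -
        have "R powr (- p) = exp (- (p * ln R))" using assms(4) by (simp add: powr_def)
        moreover have "((p - 1) / p) powr p = exp (p * (ln (p - 1) - ln p))" using p by (simp add: powr_def ln_div)
        moreover have "(1 - m) powr (- (p * (1 - m) / m)) = exp (- (k * (real n - 1) * (ln (real n - 1) - ln (p - 1))))"
          unfolding k(1) unfolding m1 using p n by (simp add: powr_def ln_div)
        ultimately show ?thesis by (simp only: exp_add[symmetric]) (simp add: algebra_simps)
      qed
      also have "- (p * ln R) + p * (ln (p - 1) - ln p) - k * (real n - 1) * (ln (real n - 1) - ln (p - 1))
         = - (p * (ln p + ln R)) + k * ((p - 1) * ln (p - 1) - (real n - 1) * ln (real n - 1))"
      proof -
        have "p * ln (p - 1) = (k * (p - 1) - k * (real n - 1)) * ln (p - 1)" using k(2) by simp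
        then show ?thesis by (simp add: algebra_simps)
      qed
      also have "exp \<dots> = (1 / (p * R)) powr p * (((p - 1) powr (p - 1)) / ((real n - 1) powr (real n - 1))) powr k"
        using p n assms(4) by (simp add: powr_def ln_div ln_mult exp_add[symmetric] algebra_simps)
      finally show ?thesis by (simp add: k_def)
    qed
    moreover have "p / (4 * (p - 1)) / ((1 + s) - 2 * ln (m * \<tau>))\<^sup>2
        = p / (4 * (p - 1)) * (1 + s - 2 * ln m - 2 * ln \<tau>) powi (- 2)"
      using m \<tau> by (simp add: ln_mult power_int_minus divide_inverse algebra_simps)
    ultimately show ?thesis unfolding \<Lambda>_def by (simp add: mult.assoc[symmetric])
  qed
  finally show ?thesis using \<tau> by simp
qed

end
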